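(* Let $\mathscr{H}$ be a complex Hilbert space, let $T_i\in\mathbb{B}(\mathscr{H})$ $(1\leq i\leq n)$, $0\leq\alpha\leq1$, $p\geq2$ and $N\in\mathbb{N}$. Then $$w_p^p(T_1,\dots,T_n)\leq\Big\|\sum_{i=1}^n\big(\alpha|T_i|^p+(1-\alpha)|T_i^*|^p\big)\Big\|-\inf_{\|x\|=1}\eta(x),$$ where $$\eta(x)=\sum_{i=1}^n\sum_{j=1}^N\Big((-1)^{r_j}2^{j-1}\alpha+(-1)^{r_j+1}\Big\lfloor\frac{r_j+1}{2}\Big\rfloor\Big)\Big(\sqrt[2^j]{\langle|T_i^*|^px,x\rangle^{2^{j-1}-k_j}\langle|T_i|^px,x\rangle^{k_j}}-\sqrt[2^j]{\langle|T_i|^px,x\rangle^{k_j+1}\langle|T_i^*|^px,x\rangle^{2^{j-1}-k_j-1}}\Big)^2,$$ with $r_j=\lfloor2^j\alpha\rfloor$ and $k_j=\lfloor2^{j-1}\alpha\rfloor$.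
   Context: $\mathbb{B}(\mathscr{H})$ is the algebra of bounded linear operators on $\mathscr{H}$ with the operator norm $\|\cdot\|$, and $|T|=(T^*T)^{1/2}$. For $p\ge1$, $w_p(T_1,\dots,T_n)=\sup_{\|x\|=1}\left(\sum_{i=1}^n|\langle T_ix,x\rangle|^p\right)^{1/p}$, and $w_p^p$ is its $p$-th power. Powers of positive operators are given by functional calculus. $\lfloor\cdot\rfloor$ is the greatest integer function, $\mathbb{N}=\{1,2,\dots\}$, and $0^0=1$. When $\alpha=1$ all the coefficients in $\eta$ are $0$ and $\eta$ is understood to be $0$. *)

theory Defs
  imports "HOL-Analysis.Analysis" "HOL-Computational_Algebra.Polynomial"
begin

text \<open>Complex inner product spaces, with the inner product linear in its first argument.
  Positive definiteness of \<open>cinner\<close> is contained in \<open>cinner_self\<close> and the norm axioms.\<close>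

class complex_inner = real_normed_vector +
  fixes scaleC :: "complex \<Rightarrow> 'a \<Rightarrow> 'a" (infixr "*\<^sub>C" 75)
    and cinner :: "'a \<Rightarrow> 'a \<Rightarrow> complex"
  assumes scaleC_add_right: "c *\<^sub>C (x + y) = c *\<^sub>C x + c *\<^sub>C y"
    and scaleC_add_left: "(c + d) *\<^sub>C x = c *\<^sub>C x + d *\<^sub>C x"
    and scaleC_scaleC: "c *\<^sub>C (d *\<^sub>C x) = (c * d) *\<^sub>C x"
    and scaleC_of_real: "complex_of_real r *\<^sub>C x = r *\<^sub>R x"
    and cinner_commute: "cinner x y = cnj (cinner y x)"
    and cinner_add_left: "cinner (x + y) z = cinner x z + cinner y z"
    and cinner_scaleC_left: "cinner (c *\<^sub>C x) y = c * cinner x y"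
    and cinner_self: "cinner x x = complex_of_real ((norm x)\<^sup>2)"

class chilbert_space = complex_inner + complete_space

text \<open>The bounded operators on the complex Hilbert space: the complex-linear elements of the
  library type of bounded real-linear maps, whose norm is the operator norm.\<close>

definition bounded_operators :: "('a::complex_inner \<Rightarrow>\<^sub>L 'a) set" where
  "bounded_operators = {T. \<forall>c x. blinfun_apply T (c *\<^sub>C x) = c *\<^sub>C blinfun_apply T x}"

definition hadjoint :: "('a::complex_inner \<Rightarrow>\<^sub>L 'a) \<Rightarrow> ('a \<Rightarrow>\<^sub>L 'a)" where
  "hadjoint T = (THE S. \<forall>x y. cinner (blinfun_apply T x) y = cinner x (blinfun_apply S y))"

definition op_spectrum :: "('a::complex_inner \<Rightarrow>\<^sub>L 'a) \<Rightarrow> complex set" where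
  "op_spectrum A = {z. \<not> (\<exists>B\<in>bounded_operators. \<forall>x.
      blinfun_apply B (blinfun_apply A x - z *\<^sub>C x) = x \<and>
      blinfun_apply A (blinfun_apply B x) - z *\<^sub>C blinfun_apply B x = x)}"

definition op_poly :: "real poly \<Rightarrow> ('a::complex_inner \<Rightarrow>\<^sub>L 'a) \<Rightarrow> ('a \<Rightarrow>\<^sub>L 'a)" where
  "op_poly q A = (\<Sum>i\<le>degree q. coeff q i *\<^sub>R ((\<lambda>B. A o\<^sub>L B) ^^ i) id_blinfun)"

text \<open>Continuous functional calculus of a self-adjoint operator \<open>A\<close>: \<open>f(A)\<close> is the limit in
  operator norm of \<open>q\<^sub>m(A)\<close>, for any real polynomials \<open>q\<^sub>m\<close> converging to \<open>f\<close> uniformly on the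
  spectrum. The spectrum of such an operator is real, so \<open>Re\<close> only changes its type.\<close>

definition fun_calc :: "(real \<Rightarrow> real) \<Rightarrow> ('a::complex_inner \<Rightarrow>\<^sub>L 'a) \<Rightarrow> ('a \<Rightarrow>\<^sub>L 'a)" where
  "fun_calc f A = (THE B. \<forall>q :: nat \<Rightarrow> real poly.
      uniform_limit (Re ` op_spectrum A) (\<lambda>m t. poly (q m) t) f sequentially \<longrightarrow>
      (\<lambda>m. op_poly (q m) A) \<longlonglongrightarrow> B)"

text \<open>Powers of positive operators, for exponents \<open>s > 0\<close> (\<open>0 powr 0 = 0\<close> would give
  the wrong function for \<open>s = 0\<close>).\<close>

definition op_powr :: "('a::complex_inner \<Rightarrow>\<^sub>L 'a) \<Rightarrow> real \<Rightarrow> ('a \<Rightarrow>\<^sub>L 'a)" where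
  "op_powr A s = fun_calc (\<lambda>t. t powr s) A"

definition op_abs :: "('a::complex_inner \<Rightarrow>\<^sub>L 'a) \<Rightarrow> ('a \<Rightarrow>\<^sub>L 'a)" where
  "op_abs T = op_powr (hadjoint T o\<^sub>L T) (1/2)"

definition joint_num_radius :: "real \<Rightarrow> nat \<Rightarrow> (nat \<Rightarrow> ('a::complex_inner \<Rightarrow>\<^sub>L 'a)) \<Rightarrow> real" where
  "joint_num_radius p n T = (SUP x\<in>{x. norm x = 1}.
      (\<Sum>i=1..n. (cmod (cinner (blinfun_apply (T i) x) x)) powr p) powr (1/p))"

text \<open>\<open>\<langle>A x, x\<rangle>\<close>, which is real for the positive operators \<open>A\<close> used here.\<close>

definition quad_form :: "('a::complex_inner \<Rightarrow>\<^sub>L 'a) \<Rightarrow> 'a \<Rightarrow> real" where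
  "quad_form A x = Re (cinner (blinfun_apply A x) x)"

definition r_idx :: "real \<Rightarrow> nat \<Rightarrow> nat" where
  "r_idx \<alpha> j = nat \<lfloor>2^j * \<alpha>\<rfloor>"

definition k_idx :: "real \<Rightarrow> nat \<Rightarrow> nat" where
  "k_idx \<alpha> j = nat \<lfloor>2^(j - 1) * \<alpha>\<rfloor>"

definition eta_coeff :: "real \<Rightarrow> nat \<Rightarrow> real" where
  "eta_coeff \<alpha> j = (-1) ^ r_idx \<alpha> j * 2^(j - 1) * \<alpha>
     + (-1) ^ (r_idx \<alpha> j + 1) * of_int \<lfloor>(real (r_idx \<alpha> j) + 1) / 2\<rfloor>"

text \<open>For \<open>\<alpha> < 1\<close> and \<open>j \<ge> 1\<close> we have \<open>k_idx \<alpha> j < 2^(j - 1)\<close>, so the truncated subtractions in the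
  exponents are exact; for \<open>\<alpha> = 1\<close> the last one truncates, but all coefficients vanish.\<close>

definition eta ::
  "real \<Rightarrow> real \<Rightarrow> nat \<Rightarrow> nat \<Rightarrow> (nat \<Rightarrow> ('a::complex_inner \<Rightarrow>\<^sub>L 'a)) \<Rightarrow> 'a \<Rightarrow> real" where
  "eta \<alpha> p N n T x = (\<Sum>i=1..n. \<Sum>j=1..N.
     (let a = quad_form (op_powr (op_abs (T i)) p) x;
          b = quad_form (op_powr (op_abs (hadjoint (T i))) p) x;
          k = k_idx \<alpha> j
      in eta_coeff \<alpha> j *
         (root (2^j) (b ^ (2^(j - 1) - k) * a ^ k)
          - root (2^j) (a ^ (k + 1) * b ^ (2^(j - 1) - k - 1)))\<^sup>2))"

end

theory Submission
  imports Defs "HOL-Computational_Algebra.Fundamental_Theorem_Algebra"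
begin

text \<open>For a unit vector \<open>x\<close> put \<open>c = |\<langle>Tx, x\<rangle>|\<^sup>p\<close>, \<open>a = \<langle>|T|\<^sup>p x, x\<rangle>\<close> and \<open>b = \<langle>|T\<^sup>*|\<^sup>p x, x\<rangle>\<close>. Cauchy--Schwarz
  gives \<open>|\<langle>Tx, x\<rangle>|\<^sup>2 \<le> \<parallel>Tx\<parallel>\<^sup>2 = \<langle>|T|\<^sup>2 x, x\<rangle>\<close>, so Jensen's inequality for \<open>u \<mapsto> u\<^sup>p\<^sup>/\<^sup>2\<close> yields \<open>c \<le> a\<close>,
  and likewise \<open>c \<le> b\<close>; no mixed Schwarz inequality is needed. Subtracting the terms of \<open>\<eta>\<close> from
  \<open>\<alpha> a + (1 - \<alpha>) b\<close> telescopes to a convex combination of two of the means \<open>a\<^sup>v b\<^sup>1\<^sup>-\<^sup>v\<close>, each of which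
  is at least \<open>c\<close>.

  The functional calculus rests on \<open>\<parallel>q(A)\<parallel> = |q(t)|\<close> for some real \<open>t\<close> in the spectrum of \<open>A\<close>: for
  \<open>B = q(A)\<close>, the operator \<open>B\<^sup>2 - \<parallel>B\<parallel>\<^sup>2\<close> is not invertible, hence neither is one of the factors of
  \<open>q\<^sup>2 - \<parallel>B\<parallel>\<^sup>2\<close> at \<open>A\<close>.\<close>

subclass (in chilbert_space) banach ..

subsection \<open>Complex inner products\<close>

lemma cinner_add_right: "cinner x (y + z) = cinner x y + cinner x (z :: 'a::complex_inner)"
  by (metis cinner_add_left cinner_commute complex_cnj_add)

lemma cinner_scaleC_right: "cinner x (c *\<^sub>C y) = cnj c * cinner x (y :: 'a::complex_inner)"
  by (metis cinner_scaleC_left cinner_commute complex_cnj_mult)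

lemma cinner_scaleR_left: "cinner (r *\<^sub>R x) y = of_real r * cinner x (y :: 'a::complex_inner)"
  by (metis cinner_scaleC_left scaleC_of_real)

lemma cinner_scaleR_right: "cinner x (r *\<^sub>R y) = of_real r * cinner x (y :: 'a::complex_inner)"
  by (metis cinner_scaleC_right scaleC_of_real complex_cnj_complex_of_real)

lemma cinner_minus_left: "cinner (- x) y = - cinner x (y :: 'a::complex_inner)"
  using cinner_scaleR_left[of "-1" x y] by simp

lemma cinner_minus_right: "cinner x (- y) = - cinner x (y :: 'a::complex_inner)"
  using cinner_scaleR_right[of x "-1" y] by simp

lemma cinner_diff_left: "cinner (x - y) z = cinner x z - cinner y (z :: 'a::complex_inner)"
  using cinner_add_left[of x "- y" z] by (simp add: cinner_minus_left)

lemma cinner_diff_right: "cinner x (y - z) = cinner x y - cinner x (z :: 'a::complex_inner)"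
  using cinner_add_right[of x y "- z"] by (simp add: cinner_minus_right)

lemma cinner_zero_left [simp]: "cinner 0 (x :: 'a::complex_inner) = 0"
  using cinner_diff_left[of x x x] by simp

lemma cinner_zero_right [simp]: "cinner (x :: 'a::complex_inner) 0 = 0"
  using cinner_diff_right[of x x x] by simp

lemma scaleC_zero_right [simp]: "c *\<^sub>C (0 :: 'a::complex_inner) = 0"
  using scaleC_add_right[of c 0 "0::'a"] by simp

lemma scaleC_minus_right: "c *\<^sub>C (- x) = - (c *\<^sub>C (x :: 'a::complex_inner))"
  using scaleC_add_right[of c x "- x"] by (simp add: eq_neg_iff_add_eq_0 add.commute)

lemma scaleC_diff_right: "c *\<^sub>C (x - y) = c *\<^sub>C x - c *\<^sub>C (y :: 'a::complex_inner)"
  using scaleC_add_right[of c x "- y"] by (simp add: scaleC_minus_right)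

lemma scaleC_scaleR: "c *\<^sub>C (r *\<^sub>R x) = r *\<^sub>R (c *\<^sub>C (x :: 'a::complex_inner))"
  by (simp add: scaleC_of_real[symmetric] scaleC_scaleC mult.commute)

lemma Re_cinner_commute: "Re (cinner x y) = Re (cinner y (x :: 'a::complex_inner))"
  by (metis cinner_commute complex_cnj(1) complex.sel(1) complex.collapse)

lemma norm_add_square:
  "(norm (x + y))\<^sup>2 = (norm x)\<^sup>2 + 2 * Re (cinner x y) + (norm (y :: 'a::complex_inner))\<^sup>2"
proof -
  have "complex_of_real ((norm (x + y))\<^sup>2) = cinner (x + y) (x + y)"
    by (simp add: cinner_self)
  also have "\<dots> = of_real ((norm x)\<^sup>2) + cinner x y + cinner y x + of_real ((norm y)\<^sup>2)"
    unfolding cinner_add_left cinner_add_right cinner_self[of x] cinner_self[of y] by simp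
  finally have "Re (complex_of_real ((norm (x + y))\<^sup>2))
      = Re (of_real ((norm x)\<^sup>2) + cinner x y + cinner y x + of_real ((norm y)\<^sup>2))"
    by (rule arg_cong)
  then show ?thesis
    unfolding plus_complex.sel Re_complex_of_real using Re_cinner_commute[of y x] by linarith
qed

lemma norm_diff_square:
  "(norm (x - y))\<^sup>2 = (norm x)\<^sup>2 - 2 * Re (cinner x y) + (norm (y :: 'a::complex_inner))\<^sup>2"
  using norm_add_square[of x "- y"] by (simp add: cinner_minus_right)

lemma norm_scaleC: "norm (c *\<^sub>C x) = cmod c * norm (x :: 'a::complex_inner)"
proof -
  have "complex_of_real ((norm (c *\<^sub>C x))\<^sup>2) = (c * cnj c) * of_real ((norm x)\<^sup>2)"
    by (simp add: cinner_self[symmetric] cinner_scaleC_left cinner_scaleC_right del: of_real_power)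
  also have "\<dots> = of_real ((cmod c * norm x)\<^sup>2)"
    by (simp add: complex_norm_square[symmetric] power_mult_distrib)
  finally have "(norm (c *\<^sub>C x))\<^sup>2 = (cmod c * norm x)\<^sup>2"
    using of_real_eq_iff by blast
  then show ?thesis by (simp add: power2_eq_iff_nonneg)
qed

lemma bounded_linear_scaleC: "bounded_linear (\<lambda>x::'a::complex_inner. c *\<^sub>C x)"
  by (intro bounded_linear_intro[where K = "cmod c"])
    (auto simp: scaleC_add_right scaleC_scaleR norm_scaleC)

lemma Re_cinner_le: "Re (cinner x y) \<le> norm x * norm (y :: 'a::complex_inner)"
proof -
  have "(norm (x + y))\<^sup>2 \<le> (norm x + norm y)\<^sup>2"
    by (simp add: norm_triangle_ineq power_mono)
  then show ?thesis
    unfolding norm_add_square by (simp add: power2_sum)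
qed

lemma cmod_cinner_le: "cmod (cinner x y) \<le> norm x * norm (y :: 'a::complex_inner)"
proof (cases "cinner x y = 0")
  case False
  \<comment> \<open>\<open>c\<close> is the phase that rotates \<open>cinner x y\<close> onto its
    modulus, which reduces the claim to the bound on real parts.\<close>
  define c where "c = cnj (cinner x y) / cmod (cinner x y)"
  have "cmod c = 1" using False by (simp add: c_def norm_divide)
  moreover have "c * cinner x y = cmod (cinner x y)"
    using False complex_norm_square[of "cinner x y"]
    by (simp add: c_def power2_eq_square field_simps)
  ultimately show ?thesis
    using Re_cinner_le[of "c *\<^sub>C x" y] by (simp add: cinner_scaleC_left norm_scaleC)
qed simp

lemma cinner_ext_right:
  assumes "\<And>x. cinner x y = cinner x (z :: 'a::complex_inner)"
  shows "y = z"
proof -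
  have "cinner (y - z) (y - z) = 0"
    using assms by (simp add: cinner_diff_right)
  then show ?thesis by (simp add: cinner_self)
qed

lemma bounded_bilinear_Re_cinner:
  "bounded_bilinear (\<lambda>x y. Re (cinner x (y :: 'a::complex_inner)))"
proof
  show "\<exists>K. \<forall>x y :: 'a. norm (Re (cinner x y)) \<le> norm x * norm y * K"
    by (rule exI[of _ 1]) (metis abs_Re_le_cmod cmod_cinner_le mult.right_neutral order_trans real_norm_def)
qed (auto simp: cinner_add_left cinner_add_right cinner_scaleR_left cinner_scaleR_right)

lemmas tendsto_Re_cinner = bounded_bilinear.tendsto[OF bounded_bilinear_Re_cinner]

text \<open>Applying the first hypothesis at \<open>(- \<i>) *\<^sub>C x\<close> recovers the
  imaginary parts. Thus adjoint identities only have to be checked on real parts, where the real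
  Riesz theorem and limits apply.\<close>

lemma cinner_eqI_Re:
  assumes "\<And>x y. Re (cinner (f x) y) = Re (cinner x (g y :: 'a::complex_inner))"
    and "\<And>c x. f (c *\<^sub>C x) = c *\<^sub>C f x"
  shows "cinner (f x) y = cinner x (g y)"
proof -
  have "Re (- \<i> * cinner (f x) y) = Re (- \<i> * cinner x (g y))"
    using assms(1)[of "(- \<i>) *\<^sub>C x" y] by (simp only: assms(2) cinner_scaleC_left)
  then show ?thesis
    using assms(1)[of x y] by (simp add: complex_eq_iff)
qed

subsection \<open>Riesz representation and adjoints\<close>

text \<open>The representing vector minimises \<open>\<parallel>v\<parallel>\<^sup>2 - 2 Re (\<phi> v)\<close>; the parallelogram law makes
  minimising sequences Cauchy.\<close>

lemma riesz_real:
  fixes \<phi> :: "'a::chilbert_space \<Rightarrow> real"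
  assumes "bounded_linear \<phi>"
  obtains u where "\<And>x. \<phi> x = Re (cinner x u)"
proof -
  interpret bounded_linear \<phi> by fact
  obtain K where K: "\<And>x. norm (\<phi> x) \<le> norm x * K" using bounded by blast
  define J where "J v = (norm v)\<^sup>2 - 2 * \<phi> v" for v
  have low: "- K\<^sup>2 \<le> J v" for v
  proof -
    have "\<phi> v \<le> norm v * K" using K[of v] by simp
    moreover have "0 \<le> (norm v - K)\<^sup>2" by simp
    ultimately show ?thesis unfolding J_def by (simp add: power2_diff)
  qed
  define m where "m = Inf (range J)"
  have bdd: "bdd_below (range J)" by (rule bdd_belowI[of _ "- K\<^sup>2"]) (use low in blast)
  have m_le: "m \<le> J v" for v unfolding m_def using bdd by (simp add: cInf_lower)
  have "\<exists>v. J v < m + inverse (real (Suc k))" for k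
  proof -
    have "Inf (range J) < m + inverse (real (Suc k))" by (simp add: m_def)
    then show ?thesis using cInf_lessD[of "range J"] by fastforce
  qed
  then obtain v where v: "\<And>k. J (v k) < m + inverse (real (Suc k))" by metis
  have par: "(norm (x - y))\<^sup>2 / 2 \<le> J x + J y - 2 * m" for x y
  proof -
    have "J x + J y - 2 * J ((1/2) *\<^sub>R (x + y)) = (norm (x - y))\<^sup>2 / 2"
      unfolding J_def norm_diff_square[of x y] norm_scaleR power_mult_distrib norm_add_square[of x y]
      by (simp add: add scaleR power2_eq_square field_simps)
    then show ?thesis using m_le[of "(1/2) *\<^sub>R (x + y)"] by linarith
  qed
  have "Cauchy v"
  proof (rule CauchyI)
    fix e :: real assume e: "0 < e"
    obtain M where M: "inverse (real (Suc M)) < e\<^sup>2 / 4"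
      using reals_Archimedean[of "e\<^sup>2 / 4"] e by auto
    show "\<exists>M. \<forall>i\<ge>M. \<forall>j\<ge>M. norm (v i - v j) < e"
    proof (intro exI allI impI)
      fix i j assume "M \<le> i" "M \<le> j"
      then have "inverse (real (Suc i)) \<le> inverse (real (Suc M))"
        "inverse (real (Suc j)) \<le> inverse (real (Suc M))"
        by (simp_all add: le_imp_inverse_le)
      then have "(norm (v i - v j))\<^sup>2 < e\<^sup>2"
        using par[of "v i" "v j"] v[of i] v[of j] M by linarith
      then show "norm (v i - v j) < e" using e by (simp add: power2_less_imp_less)
    qed
  qed
  then obtain u where u: "v \<longlonglongrightarrow> u"
    unfolding Cauchy_convergent_iff convergent_def by blast
  have "(\<lambda>k. J (v k)) \<longlonglongrightarrow> J u"
    unfolding J_def using u by (intro tendsto_intros tendsto)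
  moreover have "(\<lambda>k. J (v k)) \<longlonglongrightarrow> m"
  proof (rule tendsto_sandwich)
    show "\<forall>\<^sub>F k in sequentially. m \<le> J (v k)" by (intro always_eventually allI m_le)
    show "\<forall>\<^sub>F k in sequentially. J (v k) \<le> m + inverse (real (Suc k))"
      by (intro always_eventually allI less_imp_le v)
    show "(\<lambda>k. m) \<longlonglongrightarrow> m" by (rule tendsto_const)
    show "(\<lambda>k. m + inverse (real (Suc k))) \<longlonglongrightarrow> m"
      by (rule LIMSEQ_inverse_real_of_nat_add)
  qed
  ultimately have Ju: "J u = m" by (rule LIMSEQ_unique)
  have "\<phi> x = Re (cinner x u)" for x
  proof (rule ccontr)
    assume ne: "\<phi> x \<noteq> Re (cinner x u)"
    define d where "d = Re (cinner u x) - \<phi> x"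
    have d: "d \<noteq> 0" using ne by (simp add: d_def Re_cinner_commute)
    have key: "0 \<le> 2 * t * d + t\<^sup>2 * (norm x)\<^sup>2" for t
    proof -
      have "J (u + t *\<^sub>R x) - J u = 2 * t * d + t\<^sup>2 * (norm x)\<^sup>2"
        unfolding J_def norm_add_square d_def
        by (simp add: cinner_scaleR_right add scaleR power_mult_distrib algebra_simps)
      then show ?thesis using m_le[of "u + t *\<^sub>R x"] Ju by simp
    qed
    \<comment> \<open>The choice \<open>t = - d / n\<close> makes the quadratic in
      \<open>key\<close> negative; the summand 1 keeps \<open>n\<close> positive.\<close>
    define n where "n = (norm x)\<^sup>2 + 1"
    have n: "n > 0" "(norm x)\<^sup>2 < n" by (auto simp: n_def add_nonneg_pos)
    have "0 \<le> 2 * (- d / n) * d + (- d / n)\<^sup>2 * (norm x)\<^sup>2" by (rule key)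
    also have "\<dots> \<le> 2 * (- d / n) * d + (- d / n)\<^sup>2 * n"
      using n by (intro add_left_mono mult_left_mono) auto
    also have "\<dots> = - (d\<^sup>2 / n)" using n by (simp add: power2_eq_square field_simps)
    also have "\<dots> < 0" using n d by simp
    finally show False by simp
  qed
  then show ?thesis by (rule that)
qed

text \<open>Riesz, applied to the real functional \<open>Re (cinner (T x) y)\<close> of
  \<open>x\<close>, yields \<open>s y\<close>. Linearity of \<open>s\<close> then follows from
  uniqueness, and its bound from testing at \<open>x = s y\<close>.\<close>

lemma adjoint_exists:
  fixes T :: "'a::chilbert_space \<Rightarrow>\<^sub>L 'a"
  assumes T: "T \<in> bounded_operators"
  obtains S where "S \<in> bounded_operators" "\<And>x y. cinner (T x) y = cinner x (blinfun_apply S y)"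
proof -
  have "\<exists>u. \<forall>x. Re (cinner (T x) y) = Re (cinner x u)" for y
  proof -
    have "bounded_linear (\<lambda>x. Re (cinner (T x) y))"
      by (rule bounded_linear_compose[OF
            bounded_bilinear.bounded_linear_left[OF bounded_bilinear_Re_cinner]
            blinfun.bounded_linear_right])
    from riesz_real[OF this] show ?thesis by metis
  qed
  then obtain s where s: "\<And>x y. Re (cinner (T x) y) = Re (cinner x (s y))" by metis
  have lin: "T (c *\<^sub>C x) = c *\<^sub>C T x" for c x using T by (simp add: bounded_operators_def)
  have adj: "cinner (T x) y = cinner x (s y)" for x y
    using s lin by (rule cinner_eqI_Re)
  have add: "s (x + y) = s x + s y" for x y
    by (rule cinner_ext_right) (simp add: adj[symmetric] cinner_add_right)
  have sc: "s (c *\<^sub>C x) = c *\<^sub>C s x" for c x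
    by (rule cinner_ext_right) (simp add: adj[symmetric] cinner_scaleC_right)
  have bd: "norm (s y) \<le> norm y * norm T" for y
  proof (cases "s y = 0")
    case False
    have "(norm (s y))\<^sup>2 = Re (cinner (T (s y)) y)"
      by (simp add: adj cinner_self)
    also have "\<dots> \<le> norm (T (s y)) * norm y" by (rule Re_cinner_le)
    also have "\<dots> \<le> (norm T * norm (s y)) * norm y"
      by (intro mult_right_mono norm_blinfun) auto
    finally show ?thesis using False by (simp add: power2_eq_square mult.commute mult.left_commute)
  qed simp
  have "bounded_linear s"
    using add sc bd by (intro bounded_linear_intro[where K = "norm T"]) (auto simp: scaleC_of_real[symmetric])
  then have ap: "blinfun_apply (Blinfun s) = s" by (rule bounded_linear_Blinfun_apply)
  show ?thesis
    by (rule that[of "Blinfun s"]) (auto simp: bounded_operators_def ap sc adj)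
qed

lemma hadjoint_eqI:
  assumes "\<And>x y. cinner (blinfun_apply T x) y = cinner x (blinfun_apply S y)"
  shows "hadjoint T = S"
  unfolding hadjoint_def
proof (rule the_equality)
  fix S' assume "\<forall>x y. cinner (blinfun_apply T x) y = cinner x (blinfun_apply S' y)"
  then show "S' = S"
    by (intro blinfun_eqI cinner_ext_right) (simp add: assms[symmetric])
qed (use assms in blast)

lemma
  fixes T :: "'a::chilbert_space \<Rightarrow>\<^sub>L 'a"
  assumes "T \<in> bounded_operators"
  shows hadjoint_bounded_operators: "hadjoint T \<in> bounded_operators"
    and cinner_hadjoint: "cinner (T x) y = cinner x (hadjoint T y)"
  using adjoint_exists[OF assms] hadjoint_eqI[of T] by metis+

lemma hadjoint_hadjoint:
  fixes T :: "'a::chilbert_space \<Rightarrow>\<^sub>L 'a"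
  assumes "T \<in> bounded_operators"
  shows "hadjoint (hadjoint T) = T"
  by (rule hadjoint_eqI) (metis assms cinner_commute cinner_hadjoint)

subsection \<open>Invertible and self-adjoint operators\<close>

definition self_adjoint :: "('a::complex_inner \<Rightarrow>\<^sub>L 'a) \<Rightarrow> bool" where
  "self_adjoint A \<longleftrightarrow> A \<in> bounded_operators \<and>
     (\<forall>x y. cinner (blinfun_apply A x) y = cinner x (blinfun_apply A y))"

definition positive_op :: "('a::complex_inner \<Rightarrow>\<^sub>L 'a) \<Rightarrow> bool" where
  "positive_op A \<longleftrightarrow> self_adjoint A \<and> (\<forall>x. 0 \<le> quad_form A x)"

text \<open>Taking a plain function as argument lets \<open>A x - z *\<^sub>C x\<close> be treated
  without first packaging it as a bounded operator.\<close>

definition invertible_op :: "('a::complex_inner \<Rightarrow> 'a) \<Rightarrow> bool" where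
  "invertible_op f \<longleftrightarrow> (\<exists>B\<in>bounded_operators. \<forall>x.
     blinfun_apply B (f x) = x \<and> f (blinfun_apply B x) = x)"

lemma op_spectrum_iff:
  "z \<in> op_spectrum A \<longleftrightarrow> \<not> invertible_op (\<lambda>x. blinfun_apply A x - z *\<^sub>C x)"
  by (simp add: op_spectrum_def invertible_op_def)

lemma bounded_operators_compose:
  "A \<in> bounded_operators \<Longrightarrow> B \<in> bounded_operators \<Longrightarrow> A o\<^sub>L B \<in> bounded_operators"
  by (simp add: bounded_operators_def)

lemma invertible_op_comp:
  assumes "invertible_op f" "invertible_op g"
  shows "invertible_op (\<lambda>x. f (g x))"
proof -
  obtain F G where "F \<in> bounded_operators" "G \<in> bounded_operators"
    "\<And>x. blinfun_apply F (f x) = x \<and> f (blinfun_apply F x) = x"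
    "\<And>x. blinfun_apply G (g x) = x \<and> g (blinfun_apply G x) = x"
    using assms unfolding invertible_op_def by metis
  then show ?thesis
    unfolding invertible_op_def
    by (intro bexI[of _ "G o\<^sub>L F"]) (auto simp: bounded_operators_compose)
qed

text \<open>Lax--Milgram: \<open>x \<mapsto> x - \<rho> (C x - y)\<close> is a contraction for small \<open>\<rho>\<close>.\<close>

lemma coercive_surj:
  fixes C :: "'a::chilbert_space \<Rightarrow>\<^sub>L 'a"
  assumes \<delta>: "\<delta> > 0" and coer: "\<And>x. \<delta> * (norm x)\<^sup>2 \<le> Re (cinner (C x) x)"
  shows "\<exists>x. C x = y"
proof -
  \<comment> \<open>The summand \<open>\<delta>\<close> ensures \<open>0 < M\<close> and
    \<open>\<delta> \<le> M\<close>, hence \<open>0 \<le> k < 1\<close> below.\<close>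
  define M where "M = norm C + \<delta>"
  have M: "M > 0" "norm C \<le> M" "\<delta> \<le> M" using \<delta> by (auto simp: M_def add_nonneg_pos)
  \<comment> \<open>This value minimises
    \<open>1 - 2 * \<rho> * \<delta> + \<rho>\<^sup>2 * M\<^sup>2\<close>, the bound for the squared
    contraction factor; the minimum is \<open>k\<close>.\<close>
  define \<rho> where "\<rho> = \<delta> / M\<^sup>2"
  have \<rho>: "\<rho> > 0" using \<delta> M by (simp add: \<rho>_def)
  define k where "k = 1 - \<delta>\<^sup>2 / M\<^sup>2"
  have k: "0 \<le> k" "k < 1" using \<delta> M by (auto simp: k_def power_mono)
  have con: "norm (x - \<rho> *\<^sub>R C x) \<le> sqrt k * norm x" for x
  proof -
    have "(norm (x - \<rho> *\<^sub>R C x))\<^sup>2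
        = (norm x)\<^sup>2 - 2 * \<rho> * Re (cinner (C x) x) + \<rho>\<^sup>2 * (norm (C x))\<^sup>2"
      unfolding norm_diff_square
      by (simp add: cinner_scaleR_right power_mult_distrib Re_cinner_commute[of x])
    also have "\<dots> \<le> (norm x)\<^sup>2 - 2 * \<rho> * (\<delta> * (norm x)\<^sup>2) + \<rho>\<^sup>2 * (M * norm x)\<^sup>2"
    proof (intro add_mono diff_left_mono mult_left_mono power_mono)
      show "norm (C x) \<le> M * norm x"
        using norm_blinfun[of C x] M(2) by (meson mult_right_mono norm_ge_zero order_trans)
    qed (use \<rho> coer in auto)
    also have "\<dots> = k * (norm x)\<^sup>2"
      using M by (simp add: k_def \<rho>_def power2_eq_square field_simps)
    finally show ?thesis using k
      by (metis norm_ge_zero real_le_rsqrt real_sqrt_mult real_sqrt_unique)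
  qed
  have "dist (x - \<rho> *\<^sub>R (C x - y)) (z - \<rho> *\<^sub>R (C z - y)) \<le> sqrt k * dist x z" for x z
  proof -
    have "dist (x - \<rho> *\<^sub>R (C x - y)) (z - \<rho> *\<^sub>R (C z - y)) = norm ((x - z) - \<rho> *\<^sub>R C (x - z))"
      by (simp add: dist_norm blinfun.diff_right algebra_simps)
    then show ?thesis using con[of "x - z"] by (simp add: dist_norm)
  qed
  then have "\<exists>!x. x - \<rho> *\<^sub>R (C x - y) = x"
    using k by (intro banach_fix_type[where c = "sqrt k"]) auto
  then show ?thesis using \<rho> by auto
qed

text \<open>Coercivity and Cauchy-Schwarz give \<open>\<delta> * norm x \<le> norm (C x)\<close>. So
  \<open>C\<close> is injective, which makes the chosen right inverse \<open>D\<close> linear and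
  two-sided, with bound \<open>1 / \<delta>\<close>.\<close>

lemma coercive_invertible:
  fixes C :: "'a::chilbert_space \<Rightarrow>\<^sub>L 'a"
  assumes C: "C \<in> bounded_operators"
    and \<delta>: "\<delta> > 0" and coer: "\<And>x. \<delta> * (norm x)\<^sup>2 \<le> Re (cinner (C x) x)"
  shows "invertible_op C"
proof -
  obtain D where CD: "\<And>y. C (D y) = y" using coercive_surj[OF \<delta> coer] by metis
  have below: "\<delta> * norm x \<le> norm (C x)" for x
  proof (cases "x = 0")
    case False
    have "\<delta> * (norm x)\<^sup>2 \<le> norm (C x) * norm x"
      using coer[of x] Re_cinner_le[of "C x" x] by linarith
    then show ?thesis using False by (simp add: power2_eq_square)
  qed simp
  have inj: "x = y" if "C x = C y" for x y
    using below[of "x - y"] that \<delta> by (simp add: blinfun.diff_right mult_le_0_iff)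
  have sc: "D (c *\<^sub>C x) = c *\<^sub>C D x" for c x
    by (rule inj) (use C CD in \<open>simp add: bounded_operators_def\<close>)
  have "bounded_linear D"
  proof (rule bounded_linear_intro[where K = "1 / \<delta>"])
    show "D (x + y) = D x + D y" for x y
      by (rule inj) (simp add: CD blinfun.add_right)
    show "D (r *\<^sub>R x) = r *\<^sub>R D x" for r x
      by (rule inj) (simp add: CD blinfun.scaleR_right)
    show "norm (D x) \<le> norm x * (1 / \<delta>)" for x
      using below[of "D x"] \<delta> by (simp add: CD field_simps)
  qed
  then have ap: "blinfun_apply (Blinfun D) = D" by (rule bounded_linear_Blinfun_apply)
  show ?thesis unfolding invertible_op_def
    by (rule bexI[of _ "Blinfun D"]) (auto simp: ap CD bounded_operators_def sc intro: inj)
qed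

lemma
  assumes "self_adjoint A"
  shows self_adjoint_bounded: "A \<in> bounded_operators"
    and self_adjoint_scaleC: "blinfun_apply A (c *\<^sub>C x) = c *\<^sub>C blinfun_apply A x"
    and self_adjoint_cinner: "cinner (blinfun_apply A x) y = cinner x (blinfun_apply A y)"
  using assms by (auto simp: self_adjoint_def bounded_operators_def)

text \<open>An inverse \<open>D\<close> would keep \<open>(norm (B x))\<^sup>2\<close> below
  \<open>(l\<^sup>2 - 1 / k) * (norm x)\<^sup>2\<close> for all \<open>x\<close>, contradicting that
  \<open>l\<close> is the norm of \<open>B\<close>.\<close>

lemma self_adjoint_square_not_invertible:
  fixes B :: "'a::chilbert_space \<Rightarrow>\<^sub>L 'a"
  assumes B: "self_adjoint B" and nz: "\<exists>x::'a. x \<noteq> 0"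
  shows "\<not> invertible_op (\<lambda>x. B (B x) - (norm B)\<^sup>2 *\<^sub>R x)"
proof
  define l where "l = norm B"
  assume "invertible_op (\<lambda>x. B (B x) - (norm B)\<^sup>2 *\<^sub>R x)"
  then obtain D :: "'a \<Rightarrow>\<^sub>L 'a" where D: "\<And>x. D (B (B x) - l\<^sup>2 *\<^sub>R x) = x"
    unfolding invertible_op_def l_def by auto
  define k where "k = (norm D)\<^sup>2 * l\<^sup>2"
  have ineq: "(norm x)\<^sup>2 \<le> k * (l\<^sup>2 * (norm x)\<^sup>2 - (norm (B x))\<^sup>2)" for x
  proof -
    have "(norm (B (B x) - l\<^sup>2 *\<^sub>R x))\<^sup>2
        = (norm (B (B x)))\<^sup>2 - 2 * l\<^sup>2 * (norm (B x))\<^sup>2 + (l\<^sup>2)\<^sup>2 * (norm x)\<^sup>2"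
      unfolding norm_diff_square
      by (simp add: cinner_scaleR_right power_mult_distrib self_adjoint_cinner[OF B, of "B x" x] cinner_self)
    also have "\<dots> \<le> (l * norm (B x))\<^sup>2 - 2 * l\<^sup>2 * (norm (B x))\<^sup>2 + (l\<^sup>2)\<^sup>2 * (norm x)\<^sup>2"
      using norm_blinfun[of B "B x"] unfolding l_def by (simp add: power_mono)
    also have "\<dots> = l\<^sup>2 * (l\<^sup>2 * (norm x)\<^sup>2 - (norm (B x))\<^sup>2)"
      by (simp add: power2_eq_square algebra_simps)
    finally have 1: "(norm (B (B x) - l\<^sup>2 *\<^sub>R x))\<^sup>2 \<le> l\<^sup>2 * (l\<^sup>2 * (norm x)\<^sup>2 - (norm (B x))\<^sup>2)" .
    have "(norm x)\<^sup>2 \<le> (norm D * norm (B (B x) - l\<^sup>2 *\<^sub>R x))\<^sup>2"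
      using norm_blinfun[of D "B (B x) - l\<^sup>2 *\<^sub>R x"] by (simp add: D power_mono)
    also have "\<dots> \<le> (norm D)\<^sup>2 * (l\<^sup>2 * (l\<^sup>2 * (norm x)\<^sup>2 - (norm (B x))\<^sup>2))"
      unfolding power_mult_distrib by (rule mult_left_mono[OF 1]) simp
    finally show ?thesis by (simp add: k_def mult.assoc)
  qed
  obtain x0 :: 'a where x0: "x0 \<noteq> 0" using nz by blast
  have k0: "k \<ge> 0" by (simp add: k_def)
  have k: "k > 0" using ineq[of x0] x0 k0 by (cases "k = 0") auto
  have le: "(norm (B x))\<^sup>2 \<le> (l\<^sup>2 - 1 / k) * (norm x)\<^sup>2" for x
    using ineq[of x] k by (simp add: field_simps)
  have "0 \<le> (l\<^sup>2 - 1 / k) * (norm x0)\<^sup>2" using le[of x0] by (meson order_trans zero_le_power2)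
  then have nn: "0 \<le> l\<^sup>2 - 1 / k" using x0 by (simp add: zero_le_mult_iff)
  have "norm (B x) \<le> sqrt (l\<^sup>2 - 1 / k) * norm x" for x
    using le[of x] by (metis norm_ge_zero real_le_rsqrt real_sqrt_mult real_sqrt_unique)
  then have "l \<le> sqrt (l\<^sup>2 - 1 / k)"
    unfolding l_def by (intro norm_blinfun_bound) (use nn in \<open>auto simp: l_def\<close>)
  then have "l\<^sup>2 \<le> l\<^sup>2 - 1 / k"
    using nn by (metis l_def norm_ge_zero power_mono real_sqrt_pow2)
  then show False using k by simp
qed

subsection \<open>Polynomials of a self-adjoint operator\<close>

lemmas blinfun_compose_simps =
  bounded_bilinear.add_left[OF bounded_bilinear_blinfun_compose]
  bounded_bilinear.add_right[OF bounded_bilinear_blinfun_compose]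
  bounded_bilinear.scaleR_left[OF bounded_bilinear_blinfun_compose]
  bounded_bilinear.scaleR_right[OF bounded_bilinear_blinfun_compose]
  bounded_bilinear.zero_left[OF bounded_bilinear_blinfun_compose]
  bounded_bilinear.zero_right[OF bounded_bilinear_blinfun_compose]

lemma op_poly_0 [simp]: "op_poly 0 A = 0"
  by (simp add: op_poly_def)

text \<open>Horner's recursion; with it the algebra of \<open>op_poly\<close> is proved by induction
  over \<open>pCons\<close>.\<close>

lemma op_poly_pCons: "op_poly (pCons a q) A = a *\<^sub>R id_blinfun + (A o\<^sub>L op_poly q A)"
proof (cases "q = 0")
  case True
  then show ?thesis by (simp add: op_poly_def blinfun_compose_simps)
next
  case False
  then show ?thesis
    unfolding op_poly_def
    by (simp add: sum.atMost_Suc_shift blinfun_compose_simps del: sum.atMost_Suc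
       add: bounded_bilinear.sum_right[OF bounded_bilinear_blinfun_compose])
qed

lemma op_poly_add: "op_poly (p + q) A = op_poly p A + op_poly q A"
  by (induction p q rule: poly_induct2)
    (simp_all add: op_poly_pCons blinfun_compose_simps scaleR_add_left)

lemma op_poly_smult: "op_poly (smult c p) A = c *\<^sub>R op_poly p A"
  by (induction p) (simp_all add: op_poly_pCons blinfun_compose_simps scaleR_add_right)

lemma op_poly_diff: "op_poly (p - q) A = op_poly p A - op_poly q A"
  using op_poly_add[of p "smult (-1) q" A] unfolding op_poly_smult by simp

lemma op_poly_mult: "op_poly (p * q) A = op_poly p A o\<^sub>L op_poly q A"
proof (induction p)
  case (pCons a p)
  have "op_poly (pCons a p * q) A = a *\<^sub>R op_poly q A + (A o\<^sub>L (op_poly p A o\<^sub>L op_poly q A))"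
    by (simp add: op_poly_add op_poly_smult op_poly_pCons pCons)
  also have "\<dots> = op_poly (pCons a p) A o\<^sub>L op_poly q A"
    by (rule blinfun_eqI) (simp add: op_poly_pCons blinfun.bilinear_simps)
  finally show ?case .
qed (simp add: blinfun_compose_simps)

lemma op_poly_const [simp]: "op_poly [:c:] A = c *\<^sub>R id_blinfun"
  by (simp add: op_poly_pCons blinfun_compose_simps)

lemma op_poly_X [simp]: "op_poly [:0, 1:] A = A"
  by (rule blinfun_eqI) (simp add: op_poly_pCons blinfun.bilinear_simps)

lemma op_poly_commute:
  "blinfun_apply A (blinfun_apply (op_poly q A) x) = blinfun_apply (op_poly q A) (blinfun_apply A x)"
  using op_poly_mult[of "[:0, 1:]" q A] op_poly_mult[of q "[:0, 1:]" A]
  by (metis blinfun_apply_blinfun_compose mult.commute op_poly_X)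

lemma self_adjoint_op_poly:
  assumes A: "self_adjoint A"
  shows "self_adjoint (op_poly q A)"
proof -
  have "op_poly q A (c *\<^sub>C x) = c *\<^sub>C op_poly q A x" for c x
    by (induction q)
      (simp_all add: op_poly_pCons blinfun.bilinear_simps self_adjoint_scaleC[OF A]
        scaleC_add_right scaleC_scaleR)
  moreover have "cinner (op_poly q A x) y = cinner x (op_poly q A y)" for x y
  proof (induction q arbitrary: x y)
    case (pCons a q)
    then show ?case
      by (simp add: op_poly_pCons blinfun.bilinear_simps cinner_add_left cinner_add_right
          cinner_scaleR_left cinner_scaleR_right self_adjoint_cinner[OF A] op_poly_commute)
  qed simp
  ultimately show ?thesis by (auto simp: self_adjoint_def bounded_operators_def)
qed

lemma invertible_op_const:
  assumes "c \<noteq> 0"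
  shows "invertible_op (blinfun_apply (c *\<^sub>R id_blinfun :: 'a::complex_inner \<Rightarrow>\<^sub>L 'a))"
  unfolding invertible_op_def
  by (rule bexI[of _ "inverse c *\<^sub>R id_blinfun"])
    (use assms in \<open>auto simp: bounded_operators_def blinfun.bilinear_simps scaleC_scaleR\<close>)

section \<open>Real polynomials at complex arguments\<close>

lemma poly_map_of_real_add:
  "poly (map_poly complex_of_real (p + q)) z
    = poly (map_poly complex_of_real p) z + poly (map_poly complex_of_real q) z"
  by (induction p q rule: poly_induct2) (simp_all add: map_poly_pCons algebra_simps)

lemma poly_map_of_real_smult:
  "poly (map_poly complex_of_real (smult c p)) z = of_real c * poly (map_poly complex_of_real p) z"
  by (induction p) (simp_all add: map_poly_pCons algebra_simps)

lemma poly_map_of_real_mult: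
  "poly (map_poly complex_of_real (p * q)) z
    = poly (map_poly complex_of_real p) z * poly (map_poly complex_of_real q) z"
  by (induction p)
    (simp_all add: map_poly_pCons poly_map_of_real_add poly_map_of_real_smult algebra_simps)

lemma poly_map_of_real_of_real:
  "poly (map_poly complex_of_real p) (of_real x) = of_real (poly p x)"
  by (induction p) (simp_all add: map_poly_pCons)

text \<open>The divisor is the minimal polynomial of \<open>z\<close> over the reals. The remainder
  \<open>[:c, d:]\<close> also vanishes at \<open>z\<close>: the imaginary part forces
  \<open>d = 0\<close>, then the real part forces \<open>c = 0\<close>.\<close>

lemma poly_nonreal_root_dvd:
  fixes q :: "real poly"
  assumes z: "poly (map_poly complex_of_real q) z = 0" and im: "Im z \<noteq> 0"
  shows "[:(Re z)\<^sup>2 + (Im z)\<^sup>2, - 2 * Re z, 1:] dvd q"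
proof -
  define Q where "Q = [:(Re z)\<^sup>2 + (Im z)\<^sup>2, - 2 * Re z, 1:]"
  define r where "r = q mod Q"
  have Q0: "Q \<noteq> 0" "degree Q = 2" by (auto simp: Q_def)
  have "poly (map_poly complex_of_real Q) z = 0"
    by (simp add: Q_def complex_eq_iff map_poly_pCons power2_eq_square algebra_simps)
  moreover have "q = q div Q * Q + r" by (simp add: r_def)
  ultimately have rz: "poly (map_poly complex_of_real r) z = 0"
    using z by (metis add_0 mult_zero_right poly_map_of_real_add poly_map_of_real_mult)
  have "degree r < 2 \<or> r = 0" using degree_mod_less[of Q q] Q0 by (auto simp: r_def)
  then have "degree r \<le> 1" by auto
  then have "r = [:coeff r 0, coeff r 1:]"
    by (intro poly_eqI) (auto simp: coeff_pCons coeff_eq_0 split: nat.split)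
  then obtain c d where r: "r = [:c, d:]" by blast
  have "d = 0" using rz im by (simp add: r map_poly_pCons complex_eq_iff)
  moreover have "c = 0" using rz im calculation by (simp add: r map_poly_pCons complex_eq_iff)
  ultimately have "r = 0" by (simp add: r)
  then show ?thesis by (simp add: r_def Q_def mod_eq_0_iff_dvd)
qed

text \<open>Factor \<open>q\<close> over the reals: the quadratic factors without real roots are coercive at \<open>A\<close>.\<close>

lemma op_poly_not_invertible:
  fixes A :: "'a::chilbert_space \<Rightarrow>\<^sub>L 'a"
  assumes A: "self_adjoint A"
  shows "q \<noteq> 0 \<Longrightarrow> \<not> invertible_op (op_poly q A) \<Longrightarrow>
    \<exists>t. poly q t = 0 \<and> complex_of_real t \<in> op_spectrum A"
proof (induction "degree q" arbitrary: q rule: less_induct)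
  case less
  \<comment> \<open>Dividing off an invertible factor leaves a cofactor of smaller degree that is
    still not invertible, and whose roots are roots of \<open>q\<close>.\<close>
  have split: ?case if q: "q = f * g" and f: "degree f > 0" "invertible_op (op_poly f A)" for f g
  proof -
    have g: "g \<noteq> 0" "degree g < degree q" using less.prems q f by (auto simp: degree_mult_eq)
    have "\<not> invertible_op (op_poly g A)"
      using invertible_op_comp[OF f(2), of "op_poly g A"] less.prems(2)
      unfolding q op_poly_mult blinfun_apply_blinfun_compose[abs_def] by (auto simp: comp_def)
    from less.hyps[OF g(2) g(1) this] show ?thesis using q by auto
  qed
  show ?case
  proof (cases "degree q = 0")
    case True
    then obtain c where "q = [:c:]" by (rule degree_eq_zeroE)
    then show ?thesis using less.prems invertible_op_const[of c] by auto
  next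
    case False
    then have "\<not> constant (poly (map_poly complex_of_real q))"
      by (simp add: constant_degree degree_map_poly)
    then obtain z where z: "poly (map_poly complex_of_real q) z = 0"
      using fundamental_theorem_of_algebra by blast
    show ?thesis
    proof (cases "Im z = 0")
      case True
      then have zr: "z = complex_of_real (Re z)" by (simp add: complex_eq_iff)
      have root: "poly q (Re z) = 0"
        using z by (subst (asm) zr) (simp add: poly_map_of_real_of_real)
      then obtain g where g: "q = [:- Re z, 1:] * g" by (auto simp: poly_eq_0_iff_dvd)
      show ?thesis
      proof (cases "complex_of_real (Re z) \<in> op_spectrum A")
        case False
        have "blinfun_apply (op_poly [:- Re z, 1:] A) = (\<lambda>x. A x - complex_of_real (Re z) *\<^sub>C x)"
          by (auto simp: op_poly_pCons blinfun.bilinear_simps scaleC_of_real blinfun_compose_simps)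
        then have "invertible_op (op_poly [:- Re z, 1:] A)"
          using False by (simp add: op_spectrum_iff)
        then show ?thesis using split[OF g] by simp
      qed (use root in blast)
    next
      case False
      define Q where "Q = [:(Re z)\<^sup>2 + (Im z)\<^sup>2, - 2 * Re z, 1:]"
      obtain g where g: "q = Q * g"
        using poly_nonreal_root_dvd[OF z False] by (auto simp: Q_def)
      have "invertible_op (op_poly Q A)"
      proof (rule coercive_invertible)
        show "op_poly Q A \<in> bounded_operators"
          by (rule self_adjoint_bounded[OF self_adjoint_op_poly[OF A]])
        show "0 < (Im z)\<^sup>2" using False by simp
        fix x
        have Qx: "op_poly Q A x = ((Re z)\<^sup>2 + (Im z)\<^sup>2) *\<^sub>R x + (A (A x) - (2 * Re z) *\<^sub>R A x)"
          by (simp add: Q_def op_poly_pCons blinfun.bilinear_simps blinfun_compose_simps)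
        \<comment> \<open>Completing the square: \<open>Q\<close> at \<open>A\<close> is the square
          of \<open>A - Re z\<close> plus the scalar \<open>(Im z)\<^sup>2\<close>.\<close>
        have "Re (cinner (op_poly Q A x) x) = (Im z)\<^sup>2 * (norm x)\<^sup>2 + (norm (A x - Re z *\<^sub>R x))\<^sup>2"
          unfolding Qx norm_diff_square
          by (simp add: cinner_add_left cinner_diff_left cinner_scaleR_left cinner_scaleR_right
              self_adjoint_cinner[OF A, of "A x"] cinner_self power_mult_distrib algebra_simps)
        then show "(Im z)\<^sup>2 * (norm x)\<^sup>2 \<le> Re (cinner (op_poly Q A x) x)" by simp
      qed
      then show ?thesis using split[OF g] by (simp add: Q_def)
    qed
  qed
qed

section \<open>Spectral bounds\<close>

lemma norm_op_poly_attained: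
  fixes A :: "'a::chilbert_space \<Rightarrow>\<^sub>L 'a"
  assumes A: "self_adjoint A" and nz: "\<exists>x::'a. x \<noteq> 0"
  shows "\<exists>t. complex_of_real t \<in> op_spectrum A \<and> \<bar>poly q t\<bar> = norm (op_poly q A)"
proof -
  have *: "\<exists>t. poly (q * q - [:(norm (op_poly q A))\<^sup>2:]) t = 0 \<and> complex_of_real t \<in> op_spectrum A"
    if "q * q - [:(norm (op_poly q A))\<^sup>2:] \<noteq> 0" for q
  proof (rule op_poly_not_invertible[OF A that])
    have "blinfun_apply (op_poly (q * q - [:(norm (op_poly q A))\<^sup>2:]) A)
        = (\<lambda>x. op_poly q A (op_poly q A x) - (norm (op_poly q A))\<^sup>2 *\<^sub>R x)"
      by (auto simp: op_poly_diff op_poly_mult blinfun.bilinear_simps)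
    then show "\<not> invertible_op (op_poly (q * q - [:(norm (op_poly q A))\<^sup>2:]) A)"
      using self_adjoint_square_not_invertible[OF self_adjoint_op_poly[OF A] nz] by simp
  qed
  have "\<exists>t. poly (q * q - [:(norm (op_poly q A))\<^sup>2:]) t = 0 \<and> complex_of_real t \<in> op_spectrum A"
  proof (cases "q * q - [:(norm (op_poly q A))\<^sup>2:] = 0")
    \<comment> \<open>Here every \<open>t\<close> is a root, so only a real point of the spectrum is
      missing; the polynomial \<open>[:0, 1:]\<close>, whose square is not constant, supplies
      one.\<close>
    case True
    have "[:0, 1:] * [:0, 1:] - [:(norm (op_poly [:0, 1:] A))\<^sup>2:] \<noteq> 0" by simp
    from *[OF this] show ?thesis unfolding True by auto
  qed (rule *)
  then obtain t where "(poly q t)\<^sup>2 = (norm (op_poly q A))\<^sup>2" "complex_of_real t \<in> op_spectrum A"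
    by (auto simp: power2_eq_square)
  then show ?thesis
    by (metis abs_norm_cancel power2_eq_iff_nonneg abs_ge_zero norm_ge_zero power2_abs)
qed

lemma norm_op_poly_le:
  fixes A :: "'a::chilbert_space \<Rightarrow>\<^sub>L 'a"
  assumes "self_adjoint A" "\<exists>x::'a. x \<noteq> 0"
    and "\<And>t. t \<in> Re ` op_spectrum A \<Longrightarrow> \<bar>poly q t\<bar> \<le> M"
  shows "norm (op_poly q A) \<le> M"
  using norm_op_poly_attained[OF assms(1,2), of q] assms(3) by (metis Re_complex_of_real image_eqI)

text \<open>To the left of 0 the operator \<open>A - z\<close> is coercive with constant
  \<open>- Re z\<close>; to the right of \<open>norm A\<close> the operator \<open>z - A\<close> is,
  with constant \<open>Re z - norm A\<close>.\<close>

lemma spectrum_positive_op: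
  fixes A :: "'a::chilbert_space \<Rightarrow>\<^sub>L 'a"
  assumes A: "positive_op A"
  shows "Re ` op_spectrum A \<subseteq> {0..norm A}"
proof (rule ccontr)
  assume "\<not> ?thesis"
  then obtain z where z: "z \<in> op_spectrum A" "Re z < 0 \<or> norm A < Re z" by fastforce
  have sa: "self_adjoint A" using A by (simp add: positive_op_def)
  have bl: "bounded_linear (\<lambda>x. A x - z *\<^sub>C x)"
    by (intro bounded_linear_sub blinfun.bounded_linear_right bounded_linear_scaleC)
  define C where "C = Blinfun (\<lambda>x. A x - z *\<^sub>C x)"
  have C: "C x = A x - z *\<^sub>C x" for x
    unfolding C_def using bl by (simp add: bounded_linear_Blinfun_apply)
  have Cb: "C \<in> bounded_operators" "- C \<in> bounded_operators"
    by (auto simp: bounded_operators_def C self_adjoint_scaleC[OF sa] scaleC_diff_right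
        scaleC_scaleC mult.commute blinfun.bilinear_simps scaleC_minus_right)
  have ReC: "Re (cinner (C x) x) = quad_form A x - Re z * (norm x)\<^sup>2" for x
    by (simp add: C cinner_diff_left cinner_scaleC_left cinner_self quad_form_def)
  have "invertible_op C"
    using z(2)
  proof
    assume "Re z < 0"
    then show ?thesis
      using A by (intro coercive_invertible[OF Cb(1), where \<delta> = "- Re z"]) (auto simp: ReC positive_op_def)
  next
    assume z2: "norm A < Re z"
    have "quad_form A x \<le> norm A * (norm x)\<^sup>2" for x
    proof -
      have "quad_form A x \<le> norm (A x) * norm x" unfolding quad_form_def by (rule Re_cinner_le)
      also have "\<dots> \<le> norm A * norm x * norm x" by (intro mult_right_mono norm_blinfun) auto
      finally show ?thesis by (simp add: power2_eq_square mult.assoc)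
    qed
    then have "invertible_op (- C)"
      using z2 by (intro coercive_invertible[OF Cb(2), where \<delta> = "Re z - norm A"])
        (auto simp: blinfun.bilinear_simps cinner_minus_left ReC algebra_simps)
    moreover have "invertible_op (blinfun_apply ((-1) *\<^sub>R id_blinfun :: 'a \<Rightarrow>\<^sub>L 'a))"
      by (rule invertible_op_const) simp
    ultimately show ?thesis
      using invertible_op_comp[of "blinfun_apply ((-1) *\<^sub>R id_blinfun :: 'a \<Rightarrow>\<^sub>L 'a)" "blinfun_apply (- C)"]
      by (simp add: blinfun.bilinear_simps)
  qed
  moreover have "blinfun_apply C = (\<lambda>x. A x - z *\<^sub>C x)" by (rule ext) (rule C)
  ultimately show False using z(1) by (simp add: op_spectrum_iff)
qed

text \<open>If \<open>M\<close> bounds \<open>\<bar>q\<bar>\<close> on \<open>{0..norm A}\<close>,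
  then \<open>q - M\<close> lies in \<open>[- (M + e), 0]\<close> on the spectrum. A norm bound for
  \<open>q - M\<close> at \<open>A\<close> thus becomes a one-sided bound for
  \<open>q\<close>.\<close>

lemma quad_form_op_poly_ge:
  fixes A :: "'a::chilbert_space \<Rightarrow>\<^sub>L 'a"
  assumes A: "positive_op A" and nz: "\<exists>x::'a. x \<noteq> 0"
    and q: "\<And>t. t \<in> Re ` op_spectrum A \<Longrightarrow> - e \<le> poly q t"
  shows "- e * (norm x)\<^sup>2 \<le> quad_form (op_poly q A) x"
proof -
  have sa: "self_adjoint A" using A by (simp add: positive_op_def)
  have "bounded (poly q ` {0..norm A})"
    by (intro compact_imp_bounded compact_continuous_image continuous_intros) auto
  then obtain M where M: "\<And>t. t \<in> {0..norm A} \<Longrightarrow> \<bar>poly q t\<bar> \<le> M"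
    by (auto simp: bounded_iff simp del: atLeastAtMost_iff)
  have "norm (op_poly (q - [:M:]) A) \<le> M + e"
  proof (rule norm_op_poly_le[OF sa nz])
    fix t assume t: "t \<in> Re ` op_spectrum A"
    then have "\<bar>poly q t\<bar> \<le> M" using spectrum_positive_op[OF A] M by blast
    then show "\<bar>poly (q - [:M:]) t\<bar> \<le> M + e" using q[OF t] by auto
  qed
  then have "norm (op_poly (q - [:M:]) A x) \<le> (M + e) * norm x"
    using norm_blinfun by (meson mult_right_mono norm_ge_zero order_trans)
  then have "norm (op_poly (q - [:M:]) A x) * norm x \<le> (M + e) * norm x * norm x"
    by (intro mult_right_mono) auto
  moreover have "- Re (cinner (op_poly (q - [:M:]) A x) x) \<le> norm (op_poly (q - [:M:]) A x) * norm x"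
    using Re_cinner_le[of "- op_poly (q - [:M:]) A x" x] by (simp add: cinner_minus_left)
  moreover have "Re (cinner (op_poly (q - [:M:]) A x) x) = quad_form (op_poly q A) x - M * (norm x)\<^sup>2"
    by (simp add: op_poly_diff blinfun.bilinear_simps cinner_diff_left cinner_scaleR_left
        cinner_self quad_form_def)
  ultimately show ?thesis by (simp add: power2_eq_square algebra_simps)
qed

subsection \<open>Functional calculus of a positive operator\<close>

lemma poly_uniform_approx:
  fixes f :: "real \<Rightarrow> real"
  assumes "compact S" "continuous_on S f"
  obtains q :: "nat \<Rightarrow> real poly" where "uniform_limit S (\<lambda>m t. poly (q m) t) f sequentially"
proof -
  have "\<exists>q :: real poly. \<forall>t\<in>S. \<bar>f t - poly q t\<bar> < inverse (real (Suc m))" for m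
  proof -
    obtain g where g: "real_polynomial_function g" "\<And>t. t \<in> S \<Longrightarrow> \<bar>f t - g t\<bar> < inverse (real (Suc m))"
      using Stone_Weierstrass_real_polynomial_function[OF assms, of "inverse (real (Suc m))"] by auto
    obtain a n where "g = (\<lambda>x. \<Sum>i\<le>n. a i * x ^ i)"
      using g(1) by (auto simp: real_polynomial_function_iff_sum)
    then have "g t = poly (\<Sum>i\<le>n. monom (a i) i) t" for t
      by (simp add: poly_sum poly_monom)
    then show ?thesis using g(2) by (intro exI[of _ "\<Sum>i\<le>n. monom (a i) i"]) simp
  qed
  then obtain q :: "nat \<Rightarrow> real poly" where q: "\<And>m t. t \<in> S \<Longrightarrow> \<bar>f t - poly (q m) t\<bar> < inverse (real (Suc m))"
    by metis
  have "uniform_limit S (\<lambda>m t. poly (q m) t) f sequentially"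
  proof (rule uniform_limitI)
    fix e :: real assume "0 < e"
    then have "\<forall>\<^sub>F m in sequentially. inverse (real (Suc m)) < e"
      using LIMSEQ_inverse_real_of_nat order_tendstoD(2) by blast
    then show "\<forall>\<^sub>F m in sequentially. \<forall>t\<in>S. dist (poly (q m) t) (f t) < e"
      by eventually_elim (metis q dist_real_def abs_minus_commute order_less_trans)
  qed
  then show ?thesis by (rule that)
qed

text \<open>This shows that the description in \<open>fun_calc\<close> denotes. Weierstrass on
  \<open>{0..norm A}\<close> gives one approximating sequence, and the norm bound by values on the
  spectrum makes it Cauchy and forces every other such sequence to the same limit.\<close>

lemma fun_calc_tendsto:
  fixes A :: "'a::chilbert_space \<Rightarrow>\<^sub>L 'a"
  assumes A: "positive_op A" and nz: "\<exists>x::'a. x \<noteq> 0" and f: "continuous_on {0..} f"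
    and q: "uniform_limit (Re ` op_spectrum A) (\<lambda>m t. poly (q m) t) f sequentially"
  shows "(\<lambda>m. op_poly (q m) A) \<longlonglongrightarrow> fun_calc f A"
proof -
  have sa: "self_adjoint A" using A by (simp add: positive_op_def)
  let ?S = "Re ` op_spectrum A"
  have cont: "continuous_on {0..norm A} f" using f by (rule continuous_on_subset) auto
  obtain q0 :: "nat \<Rightarrow> real poly" where "uniform_limit {0..norm A} (\<lambda>m t. poly (q0 m) t) f sequentially"
    using poly_uniform_approx[OF _ cont] by auto
  then have q0: "uniform_limit ?S (\<lambda>m t. poly (q0 m) t) f sequentially"
    using spectrum_positive_op[OF A] uniform_limit_on_subset by blast
  have "Cauchy (\<lambda>m. op_poly (q0 m) A)"
  proof (rule CauchyI)
    fix e :: real assume e: "0 < e"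
    then obtain M where M: "\<And>m t. m \<ge> M \<Longrightarrow> t \<in> ?S \<Longrightarrow> dist (poly (q0 m) t) (f t) < e / 4"
      using q0[unfolded uniform_limit_iff eventually_sequentially, rule_format, of "e / 4"] by auto
    show "\<exists>M. \<forall>i\<ge>M. \<forall>j\<ge>M. norm (op_poly (q0 i) A - op_poly (q0 j) A) < e"
    proof (intro exI[of _ M] allI impI)
      fix i j assume "M \<le> i" "M \<le> j"
      then have "\<bar>poly (q0 i - q0 j) t\<bar> \<le> e / 2" if "t \<in> ?S" for t
        using M[of i t] M[of j t] that unfolding dist_real_def poly_diff by linarith
      from norm_op_poly_le[OF sa nz this]
      show "norm (op_poly (q0 i) A - op_poly (q0 j) A) < e" using e by (simp add: op_poly_diff)
    qed
  qed
  then obtain L where L: "(\<lambda>m. op_poly (q0 m) A) \<longlonglongrightarrow> L"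
    by (auto simp: Cauchy_convergent_iff convergent_def)
  have conv: "(\<lambda>m. op_poly (r m) A) \<longlonglongrightarrow> L"
    if r: "uniform_limit ?S (\<lambda>m t. poly (r m) t) f sequentially" for r :: "nat \<Rightarrow> real poly"
  proof -
    have "(\<lambda>m. op_poly (r m - q0 m) A) \<longlonglongrightarrow> 0"
    proof (rule tendstoI)
      fix e :: real assume e: "0 < e"
      then have "0 < e / 4" by simp
      from uniform_limitD[OF r this] uniform_limitD[OF q0 this]
      show "\<forall>\<^sub>F m in sequentially. dist (op_poly (r m - q0 m) A) 0 < e"
      proof eventually_elim
        case (elim m)
        have "\<bar>poly (r m - q0 m) t\<bar> \<le> e / 2" if "t \<in> ?S" for t
          using elim(1)[rule_format, OF that] elim(2)[rule_format, OF that]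
          unfolding dist_real_def poly_diff by linarith
        from norm_op_poly_le[OF sa nz this] show ?case using e by simp
      qed
    qed
    from tendsto_add[OF this L] show ?thesis by (simp add: op_poly_diff)
  qed
  have "fun_calc f A = L"
    unfolding fun_calc_def
  proof (rule the_equality)
    fix B assume B: "\<forall>q :: nat \<Rightarrow> real poly. uniform_limit ?S (\<lambda>m t. poly (q m) t) f sequentially \<longrightarrow>
      (\<lambda>m. op_poly (q m) A) \<longlonglongrightarrow> B"
    show "B = L" by (rule LIMSEQ_unique[OF B[rule_format, OF q0] L])
  qed (intro allI impI conv)
  then show ?thesis using conv[OF q] by simp
qed

lemma fun_calc_obtain:
  fixes A :: "'a::chilbert_space \<Rightarrow>\<^sub>L 'a"
  assumes A: "positive_op A" and nz: "\<exists>x::'a. x \<noteq> 0" and f: "continuous_on {0..} f"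
  obtains q :: "nat \<Rightarrow> real poly"
    where "uniform_limit (Re ` op_spectrum A) (\<lambda>m t. poly (q m) t) f sequentially"
      "(\<lambda>m. op_poly (q m) A) \<longlonglongrightarrow> fun_calc f A"
proof -
  have cont: "continuous_on {0..norm A} f" using f by (rule continuous_on_subset) auto
  obtain q :: "nat \<Rightarrow> real poly" where "uniform_limit {0..norm A} (\<lambda>m t. poly (q m) t) f sequentially"
    using poly_uniform_approx[OF _ cont] by auto
  then have "uniform_limit (Re ` op_spectrum A) (\<lambda>m t. poly (q m) t) f sequentially"
    using spectrum_positive_op[OF A] uniform_limit_on_subset by blast
  then show ?thesis using that fun_calc_tendsto[OF assms] by blast
qed

lemma tendsto_quad_form:
  assumes "F \<longlonglongrightarrow> L"
  shows "(\<lambda>m. quad_form (F m) x) \<longlonglongrightarrow> quad_form L x"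
  unfolding quad_form_def
  by (intro tendsto_Re_cinner tendsto_const blinfun.tendsto assms)

lemma self_adjoint_limit:
  fixes F :: "nat \<Rightarrow> ('a::complex_inner \<Rightarrow>\<^sub>L 'a)"
  assumes F: "\<And>m. self_adjoint (F m)" and lim: "F \<longlonglongrightarrow> L"
  shows "self_adjoint L"
proof -
  have lim': "(\<lambda>m. F m x) \<longlonglongrightarrow> L x" for x
    by (intro blinfun.tendsto lim tendsto_const)
  have sc: "L (c *\<^sub>C x) = c *\<^sub>C L x" for c x
  proof (rule LIMSEQ_unique[OF lim'])
    show "(\<lambda>m. F m (c *\<^sub>C x)) \<longlonglongrightarrow> c *\<^sub>C L x"
      unfolding self_adjoint_scaleC[OF F] by (rule bounded_linear.tendsto[OF bounded_linear_scaleC lim'])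
  qed
  moreover have "cinner (L x) y = cinner x (L y)" for x y
  proof (rule cinner_eqI_Re[OF _ sc])
    fix x y
    show "Re (cinner (L x) y) = Re (cinner x (L y))"
    proof (rule LIMSEQ_unique)
      show "(\<lambda>m. Re (cinner (F m x) y)) \<longlonglongrightarrow> Re (cinner (L x) y)"
        by (intro tendsto_Re_cinner lim' tendsto_const)
      show "(\<lambda>m. Re (cinner (F m x) y)) \<longlonglongrightarrow> Re (cinner x (L y))"
        unfolding self_adjoint_cinner[OF F] by (intro tendsto_Re_cinner lim' tendsto_const)
    qed
  qed
  ultimately show ?thesis by (simp add: self_adjoint_def bounded_operators_def)
qed

text \<open>Eventually \<open>q m - g \<ge> - e\<close> on the spectrum, so the polynomial case
  passes to the limit. Taking \<open>g = 0\<close> gives positivity of square roots; a tangent as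
  \<open>g\<close> gives the Jensen step.\<close>

lemma quad_form_fun_calc_ge:
  fixes A :: "'a::chilbert_space \<Rightarrow>\<^sub>L 'a"
  assumes A: "positive_op A" and nz: "\<exists>x::'a. x \<noteq> 0" and f: "continuous_on {0..} f"
    and g: "\<And>t. 0 \<le> t \<Longrightarrow> poly g t \<le> f t"
  shows "quad_form (op_poly g A) x \<le> quad_form (fun_calc f A) x"
proof -
  obtain q :: "nat \<Rightarrow> real poly"
    where q: "uniform_limit (Re ` op_spectrum A) (\<lambda>m t. poly (q m) t) f sequentially"
      "(\<lambda>m. op_poly (q m) A) \<longlonglongrightarrow> fun_calc f A"
    using fun_calc_obtain[OF A nz f] .
  have "quad_form (op_poly g A) x - e * (norm x)\<^sup>2 \<le> quad_form (fun_calc f A) x" if e: "0 < e" for e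
  proof (rule tendsto_lowerbound[OF tendsto_quad_form[OF q(2)]])
    show "\<forall>\<^sub>F m in sequentially. quad_form (op_poly g A) x - e * (norm x)\<^sup>2 \<le> quad_form (op_poly (q m) A) x"
      using uniform_limitD[OF q(1) e]
    proof eventually_elim
      case (elim m)
      have "- e \<le> poly (q m - g) t" if t: "t \<in> Re ` op_spectrum A" for t
        using elim[rule_format, OF t] g[of t] subsetD[OF spectrum_positive_op[OF A] t]
        unfolding dist_real_def poly_diff by fastforce
      from quad_form_op_poly_ge[OF A nz this, of x] show ?case
        by (simp add: quad_form_def op_poly_diff blinfun.bilinear_simps cinner_diff_left)
    qed
  qed simp
  then have le: "quad_form (op_poly g A) x \<le> quad_form (fun_calc f A) x + e * (norm x)\<^sup>2"
    if "0 < e" for e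
    using that by (simp add: algebra_simps)
  show ?thesis
  proof (rule field_le_epsilon)
    fix e :: real assume e: "0 < e"
    \<comment> \<open>The summand 1 keeps the denominator positive when
      \<open>x = 0\<close>.\<close>
    have n: "0 < (norm x)\<^sup>2 + 1" by (simp add: add_nonneg_pos)
    then have "e / ((norm x)\<^sup>2 + 1) * (norm x)\<^sup>2 \<le> e" using e by (simp add: field_simps)
    moreover have "0 < e / ((norm x)\<^sup>2 + 1)" using e n by simp
    ultimately show "quad_form (op_poly g A) x \<le> quad_form (fun_calc f A) x + e"
      using le[of "e / ((norm x)\<^sup>2 + 1)"] by linarith
  qed
qed

section \<open>Square roots and tangents of power functions\<close>

lemma continuous_on_powr_const:
  "0 < s \<Longrightarrow> continuous_on {0..} (\<lambda>t::real. t powr s)"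
  by (intro continuous_on_powr' continuous_intros) auto

lemma
  fixes A :: "'a::chilbert_space \<Rightarrow>\<^sub>L 'a"
  assumes A: "positive_op A" and nz: "\<exists>x::'a. x \<noteq> 0"
  shows positive_op_sqrt: "positive_op (op_powr A (1/2))"
    and op_powr_sqrt_square: "op_powr A (1/2) o\<^sub>L op_powr A (1/2) = A"
proof -
  let ?S = "Re ` op_spectrum A" and ?f = "\<lambda>t::real. t powr (1/2)"
  have sa: "self_adjoint A" using A by (simp add: positive_op_def)
  have f: "continuous_on {0..} ?f" by (rule continuous_on_powr_const) simp
  obtain q :: "nat \<Rightarrow> real poly"
    where q: "uniform_limit ?S (\<lambda>m t. poly (q m) t) ?f sequentially"
      "(\<lambda>m. op_poly (q m) A) \<longlonglongrightarrow> op_powr A (1/2)"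
    using fun_calc_obtain[OF A nz f] unfolding op_powr_def .
  have "self_adjoint (op_powr A (1/2))"
    by (rule self_adjoint_limit[OF self_adjoint_op_poly[OF sa] q(2)])
  moreover have "0 \<le> quad_form (op_powr A (1/2)) x" for x
    using quad_form_fun_calc_ge[OF A nz f, of 0 x] by (simp add: op_powr_def quad_form_def)
  ultimately show "positive_op (op_powr A (1/2))" by (simp add: positive_op_def)
  \<comment> \<open>\<open>?g\<close> is the identity on the nonnegative reals. Kept as a product,
    it is the uniform limit of the squares \<open>q m * q m\<close>; the constant sequence
    \<open>[:0, 1:]\<close> evaluates the same calculus to \<open>A\<close>.\<close>
  let ?g = "\<lambda>t::real. t powr (1/2) * t powr (1/2)"
  have g: "continuous_on {0..} ?g" by (intro continuous_intros f)
  have sub: "?S \<subseteq> {0..norm A}" by (rule spectrum_positive_op[OF A])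
  have "bounded (?f ` {0..norm A})"
    by (intro compact_imp_bounded compact_continuous_image continuous_on_subset[OF f]) auto
  \<comment> \<open>The product rule for uniform limits requires bounded limit functions.\<close>
  then have "bounded (?f ` ?S)" by (rule bounded_subset) (use sub in blast)
  then have "uniform_limit ?S (\<lambda>m t. poly (q m * q m) t) ?g sequentially"
    unfolding poly_mult using q(1) by (intro uniform_lim_mult)
  from fun_calc_tendsto[OF A nz g this]
  have 1: "(\<lambda>m. (op_poly (q m) A o\<^sub>L op_poly (q m) A)) \<longlonglongrightarrow> fun_calc ?g A"
    by (simp add: op_poly_mult)
  have 2: "(\<lambda>m. (op_poly (q m) A o\<^sub>L op_poly (q m) A)) \<longlonglongrightarrow> (op_powr A (1/2) o\<^sub>L op_powr A (1/2))"
    by (intro bounded_bilinear.tendsto[OF bounded_bilinear_blinfun_compose] q(2))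
  have "uniform_limit ?S (\<lambda>(m::nat) t. poly [:0, 1:] t) ?g sequentially"
  proof (rule uniform_limitI, intro always_eventually allI ballI)
    fix e t :: real assume "0 < e" "t \<in> ?S"
    then show "dist (poly [:0, 1:] t) (?g t) < e"
      using sub by (auto simp: powr_add[symmetric])
  qed
  from fun_calc_tendsto[OF A nz g this] have "fun_calc ?g A = A"
    using LIMSEQ_unique[OF _ tendsto_const[of A]] by simp
  with LIMSEQ_unique[OF 1 2] show "op_powr A (1/2) o\<^sub>L op_powr A (1/2) = A" by simp
qed

text \<open>Convexity gives the tangent bound on the open half-line; the boundary is checked by
  hand. For \<open>c = 0\<close> the left side is 0, also at \<open>s = 1\<close>, because
  \<open>0 powr 0 = 0\<close>.\<close>

lemma powr_ge_tangent:
  fixes u c s :: real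
  assumes "0 \<le> u" "0 \<le> c" "1 \<le> s"
  shows "c powr s + s * c powr (s - 1) * (u - c) \<le> u powr s"
proof (cases "c = 0 \<or> u = 0")
  case True
  then show ?thesis
  proof
    assume u: "u = 0"
    show ?thesis
    proof (cases "c = 0")
      case False
      then have "c powr (s - 1) * c = c powr s"
        using assms by (simp add: powr_diff)
      then show ?thesis
        using assms u mult_right_mono[of 1 s "c powr s"] by (simp add: algebra_simps)
    qed (use assms u in auto)
  qed (use assms in auto)
next
  case False
  then have pos: "0 < c" "0 < u" using assms by auto
  have "s * c powr (s - 1) * (u - c) \<le> u powr s - c powr s"
  proof (rule convex_on_imp_above_tangent[where A = "{0<..}"])
    show "convex_on {0<..} (\<lambda>x. x powr s)"
      by (rule powr_convex) (rule assms)
    show "((\<lambda>x. x powr s) has_real_derivative s * c powr (s - 1)) (at c within {0<..})"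
      using pos by (auto intro!: derivative_eq_intros)
  qed (use pos in \<open>auto intro: connected_Ioi simp: interior_open\<close>)
  then show ?thesis by simp
qed

subsection \<open>Bounding \<open>|\<langle>Tx, x\<rangle>|\<^sup>p\<close>\<close>

text \<open>McCarthy's inequality: Jensen via the tangent to \<open>u \<mapsto> u powr (p / 2)\<close> at \<open>\<langle>R\<^sup>2 x, x\<rangle>\<close>.\<close>

lemma quad_form_op_powr_ge:
  fixes R :: "'a::chilbert_space \<Rightarrow>\<^sub>L 'a"
  assumes R: "positive_op R" and x: "norm x = 1" and p: "p \<ge> 2"
  shows "quad_form (R o\<^sub>L R) x powr (p / 2) \<le> quad_form (op_powr R p) x"
proof -
  define c where "c = quad_form (R o\<^sub>L R) x"
  define d where "d = p / 2 * c powr (p / 2 - 1)"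
  have sa: "self_adjoint R" using R by (simp add: positive_op_def)
  have nz: "\<exists>x::'a. x \<noteq> 0" using x by (intro exI[of _ x]) auto
  have c: "0 \<le> c"
    by (simp add: c_def quad_form_def self_adjoint_cinner[OF sa] cinner_self)
  \<comment> \<open>The polynomial is the tangent at \<open>c\<close>, evaluated at
    \<open>t\<^sup>2\<close>. Since \<open>x\<close> is a unit vector and \<open>c\<close> the form
    of the square of \<open>R\<close>, its linear part drops out at \<open>x\<close>.\<close>
  have "quad_form (op_poly [:c powr (p / 2) - d * c, 0, d:] R) x \<le> quad_form (op_powr R p) x"
    unfolding op_powr_def
  proof (rule quad_form_fun_calc_ge[OF R nz])
    show "continuous_on {0..} (\<lambda>t. t powr p)" using p by (intro continuous_on_powr_const) simp
    fix t :: real assume t: "0 \<le> t"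
    have "(t\<^sup>2) powr (p / 2) = t powr p"
      using t powr_powr[of t 2 "p / 2"] by simp
    moreover have "poly [:c powr (p / 2) - d * c, 0, d:] t = c powr (p / 2) + d * (t\<^sup>2 - c)"
      by (simp add: power2_eq_square algebra_simps)
    ultimately show "poly [:c powr (p / 2) - d * c, 0, d:] t \<le> t powr p"
      using powr_ge_tangent[of "t\<^sup>2" c "p / 2"] c p by (simp add: d_def)
  qed
  moreover have "quad_form (op_poly [:c powr (p / 2) - d * c, 0, d:] R) x = c powr (p / 2)"
    by (simp add: op_poly_pCons quad_form_def blinfun.bilinear_simps blinfun_compose_simps
        cinner_add_left cinner_diff_left cinner_scaleR_left cinner_self x c_def)
  ultimately show ?thesis by (simp add: c_def)
qed

lemma positive_op_hadjoint_compose: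
  fixes T :: "'a::chilbert_space \<Rightarrow>\<^sub>L 'a"
  assumes T: "T \<in> bounded_operators"
  shows "positive_op (hadjoint T o\<^sub>L T)"
    and "quad_form (hadjoint T o\<^sub>L T) x = (norm (T x))\<^sup>2"
proof -
  have adj: "cinner (hadjoint T u) y = cinner u (T y)" for u y
    using cinner_hadjoint[OF hadjoint_bounded_operators[OF T]] by (simp add: hadjoint_hadjoint[OF T])
  show q: "quad_form (hadjoint T o\<^sub>L T) x = (norm (T x))\<^sup>2" for x
    by (simp add: quad_form_def adj cinner_self)
  show "positive_op (hadjoint T o\<^sub>L T)"
    unfolding positive_op_def self_adjoint_def q
    using bounded_operators_compose[OF hadjoint_bounded_operators[OF T] T]
    by (simp add: adj cinner_hadjoint[OF T])
qed

lemma cmod_cinner_powr_le: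
  fixes T :: "'a::chilbert_space \<Rightarrow>\<^sub>L 'a"
  assumes T: "T \<in> bounded_operators" and x: "norm x = 1" and p: "p \<ge> 2"
  shows "cmod (cinner (T x) x) powr p \<le> quad_form (op_powr (op_abs T) p) x"
proof -
  let ?H = "hadjoint T o\<^sub>L T"
  have nz: "\<exists>x::'a. x \<noteq> 0" using x by (intro exI[of _ x]) auto
  have H: "positive_op ?H" by (rule positive_op_hadjoint_compose[OF T])
  have "cmod (cinner (T x) x) powr p \<le> norm (T x) powr p"
    using cmod_cinner_le[of "T x" x] x p by (intro powr_mono2) auto
  also have "\<dots> = ((norm (T x))\<^sup>2) powr (p / 2)"
    using powr_powr[of "norm (T x)" 2 "p / 2"] by simp
  also have "\<dots> = quad_form (op_abs T o\<^sub>L op_abs T) x powr (p / 2)"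
    unfolding op_abs_def op_powr_sqrt_square[OF H nz] positive_op_hadjoint_compose(2)[OF T] ..
  also have "\<dots> \<le> quad_form (op_powr (op_abs T) p) x"
    unfolding op_abs_def by (rule quad_form_op_powr_ge[OF positive_op_sqrt[OF H nz] x p])
  finally show ?thesis .
qed

lemma cmod_cinner_powr_le_adjoint:
  fixes T :: "'a::chilbert_space \<Rightarrow>\<^sub>L 'a"
  assumes T: "T \<in> bounded_operators" and x: "norm x = 1" and p: "p \<ge> 2"
  shows "cmod (cinner (T x) x) powr p \<le> quad_form (op_powr (op_abs (hadjoint T)) p) x"
proof -
  have "cmod (cinner (T x) x) = cmod (cinner (hadjoint T x) x)"
    unfolding cinner_hadjoint[OF T] by (subst cinner_commute) simp
  then show ?thesis
    using cmod_cinner_powr_le[OF hadjoint_bounded_operators[OF T] x p] by simp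
qed

subsection \<open>Refined Young inequality\<close>

lemma
  assumes "0 \<le> \<alpha>"
  shows r_idx_le: "real (r_idx \<alpha> i) \<le> 2 ^ i * \<alpha>"
    and r_idx_gt: "2 ^ i * \<alpha> < real (r_idx \<alpha> i) + 1"
  using assms by (simp_all add: r_idx_def)

lemma k_idx_Suc: "k_idx \<alpha> (Suc i) = r_idx \<alpha> i"
  by (simp add: k_idx_def r_idx_def)

lemma r_idx_eqI:
  assumes "real m \<le> 2 ^ i * \<alpha>" "2 ^ i * \<alpha> < real m + 1"
  shows "r_idx \<alpha> i = m"
proof -
  have "\<lfloor>2 ^ i * \<alpha>\<rfloor> = int m" using assms by (intro floor_unique) auto
  then show ?thesis by (simp add: r_idx_def)
qed

text \<open>The cases are fractional part of \<open>2 ^ i * \<alpha>\<close> below 1/2 or not.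
  Either way the coefficient is the distance of \<open>2 ^ i * \<alpha>\<close> to the nearest
  integer.\<close>

lemma r_idx_Suc_cases:
  assumes "0 \<le> \<alpha>"
  obtains
    "r_idx \<alpha> (Suc i) = 2 * r_idx \<alpha> i" "eta_coeff \<alpha> (Suc i) = 2 ^ i * \<alpha> - real (r_idx \<alpha> i)"
  | "r_idx \<alpha> (Suc i) = 2 * r_idx \<alpha> i + 1" "eta_coeff \<alpha> (Suc i) = 1 - (2 ^ i * \<alpha> - real (r_idx \<alpha> i))"
proof (cases "2 ^ i * \<alpha> - real (r_idx \<alpha> i) < 1 / 2")
  case True
  have r: "r_idx \<alpha> (Suc i) = 2 * r_idx \<alpha> i"
    using True r_idx_le[OF assms, of i] by (intro r_idx_eqI) auto
  have "\<lfloor>(real (2 * r_idx \<alpha> i) + 1) / 2\<rfloor> = int (r_idx \<alpha> i)"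
    by (intro floor_unique) auto
  then show ?thesis using r by (intro that(1)) (simp_all add: eta_coeff_def)
next
  case False
  have r: "r_idx \<alpha> (Suc i) = 2 * r_idx \<alpha> i + 1"
    using False r_idx_gt[OF assms, of i] by (intro r_idx_eqI) auto
  have "\<lfloor>(real (2 * r_idx \<alpha> i + 1) + 1) / 2\<rfloor> = int (r_idx \<alpha> i) + 1"
    by (intro floor_unique) auto
  then show ?thesis using r by (intro that(2)) (simp_all add: eta_coeff_def)
qed

lemma eta_coeff_nonneg:
  assumes "0 \<le> \<alpha>" "1 \<le> j"
  shows "0 \<le> eta_coeff \<alpha> j"
proof -
  obtain i where j: "j = Suc i" using assms(2) by (cases j) auto
  show ?thesis
    using r_idx_le[OF assms(1), of i] r_idx_gt[OF assms(1), of i]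
    by (rule_tac r_idx_Suc_cases[OF assms(1), of i]) (auto simp: j)
qed

text \<open>\<open>dyadic_mean a b i k\<close> is \<open>a\<^sup>v b\<^sup>1\<^sup>-\<^sup>v\<close> at \<open>v = k / 2\<^sup>i\<close>.\<close>

definition dyadic_mean :: "real \<Rightarrow> real \<Rightarrow> nat \<Rightarrow> nat \<Rightarrow> real" where
  "dyadic_mean a b i k = root (2 ^ i) (a ^ k * b ^ (2 ^ i - k))"

lemma dyadic_mean_nonneg: "0 \<le> a \<Longrightarrow> 0 \<le> b \<Longrightarrow> 0 \<le> dyadic_mean a b i k"
  by (simp add: dyadic_mean_def)

lemma dyadic_mean_ge:
  assumes "0 \<le> c" "c \<le> a" "c \<le> b" "k \<le> 2 ^ i"
  shows "c \<le> dyadic_mean a b i k"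
proof -
  have "c ^ 2 ^ i = c ^ k * c ^ (2 ^ i - k)" using assms(4) by (simp flip: power_add)
  also have "\<dots> \<le> a ^ k * b ^ (2 ^ i - k)"
    using assms by (intro mult_mono power_mono) auto
  finally have "root (2 ^ i) (c ^ 2 ^ i) \<le> dyadic_mean a b i k"
    unfolding dyadic_mean_def by simp
  then show ?thesis using assms(1) by (simp add: real_root_power_cancel)
qed

lemma root_power_Suc_two: "root (2 ^ Suc i) x = sqrt (root (2 ^ i) x)"
  by (simp add: sqrt_def real_root_mult_exp)

lemma dyadic_mean_even:
  assumes "0 \<le> a" "0 \<le> b" "k \<le> 2 ^ i"
  shows "dyadic_mean a b (Suc i) (2 * k) = dyadic_mean a b i k"
proof -
  have "a ^ (2 * k) * b ^ (2 ^ Suc i - 2 * k) = (a ^ k * b ^ (2 ^ i - k))\<^sup>2"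
    by (simp add: power_mult_distrib diff_mult_distrib2 flip: power_mult mult.commute)
  then show ?thesis
    unfolding dyadic_mean_def root_power_Suc_two using assms
    by (simp add: real_root_power)
qed

text \<open>The exponent is the midpoint of two neighbours at level \<open>i\<close>, so the mean is
  the geometric mean of theirs.\<close>

lemma dyadic_mean_odd:
  assumes "0 \<le> a" "0 \<le> b" "k < 2 ^ i"
  shows "dyadic_mean a b (Suc i) (2 * k + 1) = sqrt (dyadic_mean a b i k) * sqrt (dyadic_mean a b i (k + 1))"
proof -
  have "2 ^ Suc i - (2 * k + 1) = (2 ^ i - k) + (2 ^ i - (k + 1))" using assms by simp
  then have "a ^ (2 * k + 1) * b ^ (2 ^ Suc i - (2 * k + 1))
      = (a ^ k * b ^ (2 ^ i - k)) * (a ^ (k + 1) * b ^ (2 ^ i - (k + 1)))"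
    unfolding mult_2 by (simp add: power_add ac_simps)
  then show ?thesis
    unfolding dyadic_mean_def root_power_Suc_two
    by (simp only: real_root_mult real_sqrt_mult)
qed

text \<open>The left-hand side telescopes: after \<open>N\<close> terms it is the linear interpolation, at \<open>\<alpha>\<close>,
  of \<open>v \<mapsto> a\<^sup>v b\<^sup>1\<^sup>-\<^sup>v\<close> between the two multiples of \<open>2\<^sup>-\<^sup>N\<close> next to \<open>\<alpha>\<close>.\<close>

lemma young_refinement_eq:
  fixes a b \<alpha> :: real
  assumes ab: "0 \<le> a" "0 \<le> b" and \<alpha>: "0 \<le> \<alpha>" "\<alpha> < 1"
  shows "\<alpha> * a + (1 - \<alpha>) * b - (\<Sum>j=1..N. eta_coeff \<alpha> j *
      (root (2^j) (b ^ (2^(j - 1) - k_idx \<alpha> j) * a ^ k_idx \<alpha> j)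
        - root (2^j) (a ^ (k_idx \<alpha> j + 1) * b ^ (2^(j - 1) - k_idx \<alpha> j - 1)))\<^sup>2)
    = (1 - (2^N * \<alpha> - r_idx \<alpha> N)) * dyadic_mean a b N (r_idx \<alpha> N)
      + (2^N * \<alpha> - r_idx \<alpha> N) * dyadic_mean a b N (r_idx \<alpha> N + 1)"
proof (induction N)
  case 0
  have "r_idx \<alpha> 0 = 0" using \<alpha> by (intro r_idx_eqI) auto
  then show ?case by (simp add: dyadic_mean_def)
next
  case (Suc i)
  define k where "k = r_idx \<alpha> i"
  define \<theta> where "\<theta> = 2 ^ i * \<alpha> - k"
  define P where "P = dyadic_mean a b i k"
  define Q where "Q = dyadic_mean a b i (k + 1)"
  have PQ: "0 \<le> P" "0 \<le> Q" using ab by (auto simp: P_def Q_def dyadic_mean_nonneg)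
  have "real k < 2 ^ i"
    using r_idx_le[OF \<alpha>(1), of i] \<alpha> unfolding k_def by (smt (verit) mult_less_cancel_left2 zero_less_power)
  then have k: "k < 2 ^ i" by (metis of_nat_less_numeral_power_cancel_iff)
  \<comment> \<open>As \<open>k_idx\<close> at \<open>Suc i\<close> is \<open>r_idx\<close> at
    \<open>i\<close>, the new term of the sum involves exactly the two current means
    \<open>P\<close> and \<open>Q\<close>.\<close>
  have terms: "root (2^Suc i) (b ^ (2^i - k) * a ^ k) = sqrt P"
    "root (2^Suc i) (a ^ (k + 1) * b ^ (2^i - k - 1)) = sqrt Q"
    unfolding root_power_Suc_two P_def Q_def dyadic_mean_def by (simp_all add: mult.commute)
  have sq: "(sqrt P - sqrt Q)\<^sup>2 = P + Q - 2 * (sqrt P * sqrt Q)"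
    using PQ by (simp add: power2_diff)
  have even: "dyadic_mean a b (Suc i) (2 * k) = P" "dyadic_mean a b (Suc i) (2 * k + 2) = Q"
    using dyadic_mean_even[OF ab, of k i] dyadic_mean_even[OF ab, of "k + 1" i] k
    by (auto simp: P_def Q_def)
  have odd: "dyadic_mean a b (Suc i) (2 * k + 1) = sqrt P * sqrt Q"
    using dyadic_mean_odd[OF ab k] by (simp add: P_def Q_def)
  \<comment> \<open>Subtracting with coefficient \<open>\<theta>\<close> leaves
    \<open>(1 - 2 * \<theta>) * P + 2 * \<theta> * sqrt P * sqrt Q\<close>; with
    \<open>1 - \<theta>\<close> it leaves \<open>(2 - 2 * \<theta>) * sqrt P * sqrt Q + (2 *
    \<theta> - 1) * Q\<close>.\<close>
  have "(1 - \<theta>) * P + \<theta> * Q - eta_coeff \<alpha> (Suc i) * (sqrt P - sqrt Q)\<^sup>2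
     = (1 - (2^Suc i * \<alpha> - r_idx \<alpha> (Suc i))) * dyadic_mean a b (Suc i) (r_idx \<alpha> (Suc i))
      + (2^Suc i * \<alpha> - r_idx \<alpha> (Suc i)) * dyadic_mean a b (Suc i) (r_idx \<alpha> (Suc i) + 1)"
  proof (rule r_idx_Suc_cases[OF \<alpha>(1), of i, folded k_def, folded \<theta>_def])
    assume r: "r_idx \<alpha> (Suc i) = 2 * k" and e: "eta_coeff \<alpha> (Suc i) = \<theta>"
    have "2 ^ Suc i * \<alpha> - real (2 * k) = 2 * \<theta>" by (simp add: \<theta>_def)
    then show ?thesis unfolding r e sq even odd by (simp add: algebra_simps)
  next
    assume r: "r_idx \<alpha> (Suc i) = 2 * k + 1" and e: "eta_coeff \<alpha> (Suc i) = 1 - \<theta>"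
    have "2 ^ Suc i * \<alpha> - real (2 * k + 1) = 2 * \<theta> - 1" by (simp add: \<theta>_def)
    moreover have "2 * k + 1 + 1 = 2 * k + 2" by simp
    ultimately show ?thesis unfolding r e sq even odd by (simp only: even) (simp add: algebra_simps)
  qed
  then show ?case
    using Suc.IH terms by (simp add: k_idx_Suc P_def Q_def \<theta>_def flip: k_def)
qed

lemma young_refinement_ge:
  fixes a b c \<alpha> :: real
  assumes c: "0 \<le> c" "c \<le> a" "c \<le> b" and \<alpha>: "0 \<le> \<alpha>" "\<alpha> \<le> 1"
  shows "c \<le> \<alpha> * a + (1 - \<alpha>) * b - (\<Sum>j=1..N. eta_coeff \<alpha> j *
      (root (2^j) (b ^ (2^(j - 1) - k_idx \<alpha> j) * a ^ k_idx \<alpha> j)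
        - root (2^j) (a ^ (k_idx \<alpha> j + 1) * b ^ (2^(j - 1) - k_idx \<alpha> j - 1)))\<^sup>2)"
proof (cases "\<alpha> = 1")
  \<comment> \<open>At \<open>\<alpha> = 1\<close> the index \<open>r_idx \<alpha> N + 1\<close>
    would exceed \<open>2 ^ N\<close>, so the interpolation formula is avoided; the sum vanishes and
    the bound reads \<open>c \<le> a\<close>.\<close>
  case True
  have "eta_coeff \<alpha> j = 0" if jN: "j \<in> {1..N}" for j
  proof -
    obtain i where j: "j = Suc i" using jN by (cases j) auto
    have r: "r_idx \<alpha> l = 2 ^ l" for l using True by (intro r_idx_eqI) auto
    show ?thesis
      by (rule r_idx_Suc_cases[OF \<alpha>(1), of i]) (auto simp: j r[unfolded True] True)
  qed
  then show ?thesis using c True by simp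
next
  case False
  then have \<alpha>1: "\<alpha> < 1" using \<alpha> by simp
  let ?r = "r_idx \<alpha> N" and ?t = "2^N * \<alpha> - r_idx \<alpha> N"
  have "real ?r < 2 ^ N"
    using r_idx_le[OF \<alpha>(1), of N] \<alpha>1 by (smt (verit) mult_less_cancel_left2 zero_less_power)
  then have r: "?r < 2 ^ N" by (metis of_nat_less_numeral_power_cancel_iff)
  have "c = (1 - ?t) * c + ?t * c" by (simp add: algebra_simps)
  also have "\<dots> \<le> (1 - ?t) * dyadic_mean a b N ?r + ?t * dyadic_mean a b N (?r + 1)"
    using r_idx_le[OF \<alpha>(1), of N] r_idx_gt[OF \<alpha>(1), of N] r
    by (intro add_mono mult_left_mono dyadic_mean_ge c) auto
  finally show ?thesis
    using young_refinement_eq[OF _ _ \<alpha>(1) \<alpha>1, of a b N] c by simp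
qed

subsection \<open>The joint numerical radius\<close>

lemma quad_form_add: "quad_form (A + B) x = quad_form A x + quad_form B x"
  by (simp add: quad_form_def blinfun.bilinear_simps cinner_add_left)

lemma quad_form_scaleR: "quad_form (r *\<^sub>R A) x = r * quad_form A x"
  by (simp add: quad_form_def blinfun.bilinear_simps cinner_scaleR_left)

lemma quad_form_sum: "quad_form (\<Sum>i\<in>I. A i) x = (\<Sum>i\<in>I. quad_form (A i) x)"
  by (induction I rule: infinite_finite_induct) (simp_all add: quad_form_add, simp_all add: quad_form_def)

lemma quad_form_le_norm:
  assumes "norm x = 1"
  shows "quad_form A x \<le> norm A"
  using Re_cinner_le[of "blinfun_apply A x" x] norm_blinfun[of A x] assms
  by (simp add: quad_form_def)

theorem theorem2p13:
  fixes T :: "nat \<Rightarrow> ('a::chilbert_space \<Rightarrow>\<^sub>L 'a)"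
    and n N :: nat and \<alpha> p :: real
  assumes "\<exists>x::'a. x \<noteq> 0"
    and "n \<ge> 1"
    and "\<And>i. i \<in> {1..n} \<Longrightarrow> T i \<in> bounded_operators"
    and "0 \<le> \<alpha>" and "\<alpha> \<le> 1"
    and "p \<ge> 2" and "N \<ge> 1"
  shows "joint_num_radius p n T powr p
      \<le> norm (\<Sum>i=1..n. \<alpha> *\<^sub>R op_powr (op_abs (T i)) p
                        + (1 - \<alpha>) *\<^sub>R op_powr (op_abs (hadjoint (T i))) p)
        - (INF x\<in>{x. norm x = 1}. eta \<alpha> p N n T x)"
proof -
  let ?U = "{x::'a. norm x = 1}"
  define S where "S = (\<Sum>i=1..n. \<alpha> *\<^sub>R op_powr (op_abs (T i)) p
                        + (1 - \<alpha>) *\<^sub>R op_powr (op_abs (hadjoint (T i))) p)"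
  define M where "M = norm S - (INF x\<in>?U. eta \<alpha> p N n T x)"
  define w where "w x = (\<Sum>i=1..n. cmod (cinner (T i x) x) powr p)" for x
  \<comment> \<open>\<open>eta\<close> is bounded below by 0, each term being a nonnegative
    coefficient times a square; this makes the infimum a lower bound for its values.\<close>
  have bdd: "bdd_below (eta \<alpha> p N n T ` ?U)"
    using assms(4) by (intro bdd_belowI[of _ 0])
      (auto simp: eta_def Let_def intro!: sum_nonneg mult_nonneg_nonneg eta_coeff_nonneg)
  have wM: "w x \<le> M" if x: "x \<in> ?U" for x
  proof -
    have x1: "norm x = 1" using x by simp
    define a where "a i = quad_form (op_powr (op_abs (T i)) p) x" for i
    define b where "b i = quad_form (op_powr (op_abs (hadjoint (T i))) p) x" for i
    have "w x \<le> (\<Sum>i=1..n. \<alpha> * a i + (1 - \<alpha>) * b i - (\<Sum>j=1..N. eta_coeff \<alpha> j *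
      (root (2^j) (b i ^ (2^(j - 1) - k_idx \<alpha> j) * a i ^ k_idx \<alpha> j)
        - root (2^j) (a i ^ (k_idx \<alpha> j + 1) * b i ^ (2^(j - 1) - k_idx \<alpha> j - 1)))\<^sup>2))"
      unfolding w_def a_def b_def
      using assms x1 by (intro sum_mono young_refinement_ge cmod_cinner_powr_le
          cmod_cinner_powr_le_adjoint) auto
    also have "\<dots> = quad_form S x - eta \<alpha> p N n T x"
      by (simp add: S_def eta_def Let_def quad_form_sum quad_form_add quad_form_scaleR
          sum_subtractf a_def b_def)
    also have "\<dots> \<le> M"
      unfolding M_def using quad_form_le_norm[OF x1, of S] cINF_lower[OF bdd x] by linarith
    finally show ?thesis .
  qed
  \<comment> \<open>A unit vector makes the supremum range over a nonempty set and yields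
    \<open>0 \<le> M\<close>, on which the final cancellation of powers depends.\<close>
  obtain z :: 'a where "z \<noteq> 0" using assms(1) by blast
  then have z: "z /\<^sub>R norm z \<in> ?U" by simp
  have w0: "0 \<le> w x" for x by (simp add: w_def sum_nonneg)
  have M0: "0 \<le> M" using w0 wM[OF z] by (rule order_trans)
  have le: "w x powr (1 / p) \<le> M powr (1 / p)" if "x \<in> ?U" for x
    using assms(6) w0 wM[OF that] by (intro powr_mono2) auto
  have "joint_num_radius p n T \<le> M powr (1 / p)"
    unfolding joint_num_radius_def w_def[symmetric]
    by (rule cSUP_least[OF _ le]) (use z in blast)
  \<comment> \<open>Monotonicity of \<open>powr\<close> in its base is applied to nonnegative
    bases.\<close>
  moreover have "0 \<le> joint_num_radius p n T"
    unfolding joint_num_radius_def w_def[symmetric]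
    by (rule cSUP_upper2[OF _ z]) (auto intro!: bdd_aboveI2[of _ _ "M powr (1 / p)"] le)
  ultimately have "joint_num_radius p n T powr p \<le> (M powr (1 / p)) powr p"
    using assms(6) by (intro powr_mono2) auto
  also have "\<dots> = M" using assms(6) M0 by (simp add: powr_powr)
  finally show ?thesis by (simp add: M_def S_def)
qed

end
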